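(* Let $\rho$ be an invariant-extremal state supported on $V$. Then one of the following holds: (1) there is a unit vector $u\in W$ with $\rho=|u\rangle\langle u|$; (2) there is a vector $u\in V_1\ominus W$ with $\rho=\sum_{n=0}^{N-1}e^{\sum_{j=0}^{n}\beta_j}\,Z^n|u\rangle\langle u|Z^{*n}$.
   Context: Fix integers $N\ge 2$ and $n_1\ge n_2\ge\dots\ge n_N\ge 1$. Let $\mathcal H$ be a finite-dimensional complex Hilbert space with orthonormal basis $\{|-\rangle,|+\rangle\}\cup\{|a_k\rangle:1\le k\le N,\ 0\le a\le n_k-1\}$. For vectors $x,y$, $|x\rangle\langle y|$ denotes the operator $u\mapsto\langle y,u\rangle x$. Put $E_k=\mathrm{span}\{|a_k\rangle:0\le a\le n_k-1\}$, $P_k$ the orthogonal projection onto $E_k$, $P_\pm=|\pm\rangle\langle\pm|$, $\zeta_k=e^{2\pi i/n_k}$, and $\varphi_{a_k}=n_k^{-1/2}\sum_{b=0}^{n_k-1}\zeta_k^{-ba}|b_k\rangle$ for $0\le a\le n_k-1$. For $1\le k\le N-1$ let $Z_k=n_k^{-1/2}\sum_{b=0}^{n_{k+1}-1}\sum_{a=0}^{n_k-1}\zeta_k^{ba}|b_{k+1}\rangle\langle a_k|$ (an operator on $\mathcal H$), $|Z|_k=Z_k^*Z_k$. The transport operator is $Z=\sum_{k=1}^{N-1}Z_k$. Let $\omega$ range over the set $\{\omega_+,\omega_-,\omega_1,\dots,\omega_{N-1}\}$ of (distinct) Bohr frequencies, and let $\Gamma_{\pm,\omega}>0$, $\gamma_{\pm,\omega}\in\mathbb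 R$ be constants. Kraus operators: $L_{-,\omega_+}=\sqrt{n_1\Gamma_{-,\omega_+}}|\varphi_{0_1}\rangle\langle +|$, $L_{+,\omega_+}=\sqrt{n_1\Gamma_{+,\omega_+}}|+\rangle\langle\varphi_{0_1}|$, $L_{-,\omega_k}=\sqrt{\Gamma_{-,\omega_k}}Z_k$, $L_{+,\omega_k}=\sqrt{\Gamma_{+,\omega_k}}Z_k^*$ ($1\le k\le N-1$), $L_{-,\omega_-}=\sqrt{\Gamma_{-,\omega_-}}|-\rangle\langle\varphi_{0_N}|$, $L_{+,\omega_-}=0$. Effective Hamiltonian $H_{\mathrm{eff}}=n_1\gamma_{-,\omega_+}P_+-n_1\gamma_{+,\omega_+}|\varphi_{0_1}\rangle\langle\varphi_{0_1}|+\gamma_{-,\omega_-}|\varphi_{0_N}\rangle\langle\varphi_{0_N}|-\gamma_{+,\omega_-}P_-+\sum_{k=1}^{N-1}(\gamma_{-,\omega_k}|Z|_k-\gamma_{+,\omega_k}P_{k+1})$. The generator is $\mathcal L(\rho)=-i[H_{\mathrm{eff}},\rho]+\sum_{\omega}\sum_{\epsilon=\pm}\big(L_{\epsilon,\omega}\rho L_{\epsilon,\omega}^*-\tfrac12\{L_{\epsilon,\omega}^*L_{\epsilon,\omega},\rho\}\big)$. A state is a positive operator of trace one; it is invariant if $\mathcal L(\rho)=0$; it is invariant-extremal if it is invariant and is not a nontrivial convex combination of two different invariant states; an operator is supported on a subspace $E$ if its range is contained in $E$. The interaction-free subspace is $W=\bigcap_{\omega,\epsilon=\pm}(\ker L_{\epsilon,\omega}\cap\ker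 L_{\epsilon,\omega}^* )$. $V$ is the orthogonal complement of the set $\{|-\rangle,|+\rangle,Z^n\varphi_{0_1},Z^{*n}\varphi_{0_N},Z^{*s}\varphi_{0_{2m+1}}:0\le n\le N-1,\ 1\le m\le (N-1)/2,\ 1\le s\le 2m\}$, and $V_1=P_1V$. $A\ominus B$ denotes $A\cap B^\perp$. Define $\beta_k$ by $e^{\beta_k}=\Gamma_{-,\omega_k}/\Gamma_{+,\omega_k}$ for $1\le k\le N-1$, and $\beta_0=0$. *)

theory Defs
  imports Complex_Main "HOL-Library.Function_Algebras"
begin

text \<open>Basis labels of the Hilbert space: Mn = |->, Pl = |+>, Bs k a = |a_k>.
  Vectors are functions from labels to complex numbers (vanishing off the label set),
  operators are matrices (functions lbl => lbl => complex) w.r.t. this orthonormal basis.\<close>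

datatype lbl = Mn | Pl | Bs nat nat

datatype freq = Wp | Wm | Wk nat

datatype sgn = Neg | Pos

type_synonym lvec = "lbl \<Rightarrow> complex"
type_synonym lop = "lbl \<Rightarrow> lbl \<Rightarrow> complex"

definition lbls :: "nat \<Rightarrow> (nat \<Rightarrow> nat) \<Rightarrow> lbl set" where
  "lbls N n = {Mn, Pl} \<union> {Bs k a | k a. 1 \<le> k \<and> k \<le> N \<and> a < n k}"

definition freqs :: "nat \<Rightarrow> freq set" where
  "freqs N = {Wp, Wm} \<union> Wk ` {1..N-1}"

definition vecs :: "lbl set \<Rightarrow> lvec set" where
  "vecs L = {v. \<forall>i. i \<notin> L \<longrightarrow> v i = 0}"

definition ops :: "lbl set \<Rightarrow> lop set" where
  "ops L = {A. \<forall>i j. (i \<notin> L \<or> j \<notin> L) \<longrightarrow> A i j = 0}"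

definition mm :: "lbl set \<Rightarrow> lop \<Rightarrow> lop \<Rightarrow> lop" where
  "mm L A B = (\<lambda>i j. \<Sum>k\<in>L. A i k * B k j)"

definition app :: "lbl set \<Rightarrow> lop \<Rightarrow> lvec \<Rightarrow> lvec" where
  "app L A v = (\<lambda>i. \<Sum>j\<in>L. A i j * v j)"

definition adj :: "lop \<Rightarrow> lop" where
  "adj A = (\<lambda>i j. cnj (A j i))"

definition smul :: "complex \<Rightarrow> lop \<Rightarrow> lop" where
  "smul c A = (\<lambda>i j. c * A i j)"

definition outer :: "lvec \<Rightarrow> lvec \<Rightarrow> lop" where
  "outer u v = (\<lambda>i j. u i * cnj (v j))"

definition inner :: "lbl set \<Rightarrow> lvec \<Rightarrow> lvec \<Rightarrow> complex" where
  "inner L u v = (\<Sum>i\<in>L. cnj (u i) * v i)"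

definition tr :: "lbl set \<Rightarrow> lop \<Rightarrow> complex" where
  "tr L A = (\<Sum>i\<in>L. A i i)"

definition ket :: "lbl \<Rightarrow> lvec" where
  "ket l = (\<lambda>i. if i = l then 1 else 0)"

definition zeta :: "(nat \<Rightarrow> nat) \<Rightarrow> nat \<Rightarrow> complex" where
  "zeta n k = exp (2 * of_real pi * \<i> / of_nat (n k))"

definition phi :: "(nat \<Rightarrow> nat) \<Rightarrow> nat \<Rightarrow> nat \<Rightarrow> lvec" where
  "phi n k a = (\<lambda>i. case i of
      Bs k' b \<Rightarrow> if k' = k \<and> b < n k
                 then inverse (zeta n k ^ (b * a)) / of_real (sqrt (real (n k))) else 0
    | _ \<Rightarrow> 0)"

definition Pk :: "(nat \<Rightarrow> nat) \<Rightarrow> nat \<Rightarrow> lop" where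
  "Pk n k = (\<lambda>i j. case i of Bs k' b \<Rightarrow> if i = j \<and> k' = k \<and> b < n k then 1 else 0 | _ \<Rightarrow> 0)"

definition Pplus :: lop where "Pplus = outer (ket Pl) (ket Pl)"
definition Pminus :: lop where "Pminus = outer (ket Mn) (ket Mn)"

definition Zk :: "(nat \<Rightarrow> nat) \<Rightarrow> nat \<Rightarrow> lop" where
  "Zk n k = (\<lambda>i j. case (i, j) of
      (Bs k1 b, Bs k2 a) \<Rightarrow>
         if k1 = k + 1 \<and> k2 = k \<and> b < n (k + 1) \<and> a < n k
         then zeta n k ^ (b * a) / of_real (sqrt (real (n k))) else 0
    | _ \<Rightarrow> 0)"

definition absZk :: "lbl set \<Rightarrow> (nat \<Rightarrow> nat) \<Rightarrow> nat \<Rightarrow> lop" where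
  "absZk L n k = mm L (adj (Zk n k)) (Zk n k)"

definition Zop :: "nat \<Rightarrow> (nat \<Rightarrow> nat) \<Rightarrow> lop" where
  "Zop N n = (\<Sum>k\<in>{1..N-1}. Zk n k)"

definition kraus :: "nat \<Rightarrow> (nat \<Rightarrow> nat) \<Rightarrow> (freq \<Rightarrow> real) \<Rightarrow> (freq \<Rightarrow> real)
                     \<Rightarrow> freq \<Rightarrow> sgn \<Rightarrow> lop" where
  "kraus N n Gm Gp w e = (case (w, e) of
      (Wp, Neg) \<Rightarrow> smul (of_real (sqrt (real (n 1) * Gm Wp))) (outer (phi n 1 0) (ket Pl))
    | (Wp, Pos) \<Rightarrow> smul (of_real (sqrt (real (n 1) * Gp Wp))) (outer (ket Pl) (phi n 1 0))
    | (Wk k, Neg) \<Rightarrow> smul (of_real (sqrt (Gm (Wk k)))) (Zk n k)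
    | (Wk k, Pos) \<Rightarrow> smul (of_real (sqrt (Gp (Wk k)))) (adj (Zk n k))
    | (Wm, Neg) \<Rightarrow> smul (of_real (sqrt (Gm Wm))) (outer (ket Mn) (phi n N 0))
    | (Wm, Pos) \<Rightarrow> (\<lambda>i j. 0))"

definition Heff :: "nat \<Rightarrow> (nat \<Rightarrow> nat) \<Rightarrow> (freq \<Rightarrow> real) \<Rightarrow> (freq \<Rightarrow> real) \<Rightarrow> lop" where
  "Heff N n gm gp =
      smul (of_real (real (n 1) * gm Wp)) Pplus
    - smul (of_real (real (n 1) * gp Wp)) (outer (phi n 1 0) (phi n 1 0))
    + smul (of_real (gm Wm)) (outer (phi n N 0) (phi n N 0))
    - smul (of_real (gp Wm)) Pminus
    + (\<Sum>k\<in>{1..N-1}. smul (of_real (gm (Wk k))) (absZk (lbls N n) n k)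
                     - smul (of_real (gp (Wk k))) (Pk n (k + 1)))"

definition gen :: "nat \<Rightarrow> (nat \<Rightarrow> nat) \<Rightarrow> (freq \<Rightarrow> real) \<Rightarrow> (freq \<Rightarrow> real)
                   \<Rightarrow> (freq \<Rightarrow> real) \<Rightarrow> (freq \<Rightarrow> real) \<Rightarrow> lop \<Rightarrow> lop" where
  "gen N n Gm Gp gm gp \<rho> =
     (let L = lbls N n; H = Heff N n gm gp in
      smul (- \<i>) (mm L H \<rho> - mm L \<rho> H)
      + (\<Sum>w\<in>freqs N. \<Sum>e\<in>{Neg, Pos}.
           let K = kraus N n Gm Gp w e; KK = mm L (adj K) K in
           mm L (mm L K \<rho>) (adj K) - smul (1/2) (mm L KK \<rho> + mm L \<rho> KK)))"

definition positive_op :: "lbl set \<Rightarrow> lop \<Rightarrow> bool" where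
  "positive_op L A \<longleftrightarrow> A \<in> ops L \<and>
     (\<forall>v\<in>vecs L. Im (inner L v (app L A v)) = 0 \<and> Re (inner L v (app L A v)) \<ge> 0)"

definition is_state :: "lbl set \<Rightarrow> lop \<Rightarrow> bool" where
  "is_state L \<rho> \<longleftrightarrow> positive_op L \<rho> \<and> tr L \<rho> = 1"

definition invariant_state :: "nat \<Rightarrow> (nat \<Rightarrow> nat) \<Rightarrow> (freq \<Rightarrow> real) \<Rightarrow> (freq \<Rightarrow> real)
                   \<Rightarrow> (freq \<Rightarrow> real) \<Rightarrow> (freq \<Rightarrow> real) \<Rightarrow> lop \<Rightarrow> bool" where
  "invariant_state N n Gm Gp gm gp \<rho> \<longleftrightarrow>
     is_state (lbls N n) \<rho> \<and> gen N n Gm Gp gm gp \<rho> = (\<lambda>i j. 0)"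

definition invariant_extremal :: "nat \<Rightarrow> (nat \<Rightarrow> nat) \<Rightarrow> (freq \<Rightarrow> real) \<Rightarrow> (freq \<Rightarrow> real)
                   \<Rightarrow> (freq \<Rightarrow> real) \<Rightarrow> (freq \<Rightarrow> real) \<Rightarrow> lop \<Rightarrow> bool" where
  "invariant_extremal N n Gm Gp gm gp \<rho> \<longleftrightarrow>
     invariant_state N n Gm Gp gm gp \<rho> \<and>
     \<not> (\<exists>\<sigma>1 \<sigma>2 t. invariant_state N n Gm Gp gm gp \<sigma>1 \<and> invariant_state N n Gm Gp gm gp \<sigma>2
          \<and> \<sigma>1 \<noteq> \<sigma>2 \<and> 0 < t \<and> t < 1
          \<and> \<rho> = smul (of_real t) \<sigma>1 + smul (of_real (1 - t)) \<sigma>2)"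

definition supported_on :: "lbl set \<Rightarrow> lop \<Rightarrow> lvec set \<Rightarrow> bool" where
  "supported_on L A E \<longleftrightarrow> (\<forall>v\<in>vecs L. app L A v \<in> E)"

definition orth :: "lbl set \<Rightarrow> lvec set \<Rightarrow> lvec set" where
  "orth L S = {v \<in> vecs L. \<forall>s\<in>S. inner L s v = 0}"

definition Wsp :: "nat \<Rightarrow> (nat \<Rightarrow> nat) \<Rightarrow> (freq \<Rightarrow> real) \<Rightarrow> (freq \<Rightarrow> real) \<Rightarrow> lvec set" where
  "Wsp N n Gm Gp = {v \<in> vecs (lbls N n). \<forall>w\<in>freqs N. \<forall>e\<in>{Neg, Pos}.
      app (lbls N n) (kraus N n Gm Gp w e) v = (\<lambda>i. 0)
    \<and> app (lbls N n) (adj (kraus N n Gm Gp w e)) v = (\<lambda>i. 0)}"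

definition Zpow :: "nat \<Rightarrow> (nat \<Rightarrow> nat) \<Rightarrow> nat \<Rightarrow> lvec \<Rightarrow> lvec" where
  "Zpow N n m = (app (lbls N n) (Zop N n) ^^ m)"

definition Zadjpow :: "nat \<Rightarrow> (nat \<Rightarrow> nat) \<Rightarrow> nat \<Rightarrow> lvec \<Rightarrow> lvec" where
  "Zadjpow N n m = (app (lbls N n) (adj (Zop N n)) ^^ m)"

definition Vexcl :: "nat \<Rightarrow> (nat \<Rightarrow> nat) \<Rightarrow> lvec set" where
  "Vexcl N n = {ket Mn, ket Pl}
     \<union> {Zpow N n m (phi n 1 0) | m. m \<le> N - 1}
     \<union> {Zadjpow N n m (phi n N 0) | m. m \<le> N - 1}
     \<union> {Zadjpow N n s (phi n (2 * m + 1) 0) | m s. 1 \<le> m \<and> 2 * m \<le> N - 1 \<and> 1 \<le> s \<and> s \<le> 2 * m}"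

definition Vsp :: "nat \<Rightarrow> (nat \<Rightarrow> nat) \<Rightarrow> lvec set" where
  "Vsp N n = orth (lbls N n) (Vexcl N n)"

definition V1sp :: "nat \<Rightarrow> (nat \<Rightarrow> nat) \<Rightarrow> lvec set" where
  "V1sp N n = app (lbls N n) (Pk n 1) ` Vsp N n"

definition beta :: "(freq \<Rightarrow> real) \<Rightarrow> (freq \<Rightarrow> real) \<Rightarrow> nat \<Rightarrow> real" where
  "beta Gm Gp j = (if j = 0 then 0 else ln (Gm (Wk j) / Gp (Wk j)))"

end

theory Submission
  imports Defs
begin

text \<open>
  A state supported on \<open>V\<close> is annihilated by \<open>|\<plusminus>\<rangle>\<close>, \<open>\<phi>\<^bsub>0_1\<^esub>\<close> and \<open>\<phi>\<^bsub>0_N\<^esub>\<close>, so only the links \<open>Z\<^sub>k\<close> act on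
  it, and these are coisometries, \<open>Z\<^sub>k Z\<^sub>k\<^sup>* = P\<^bsub>k+1\<^esub>\<close>. An off-diagonal block \<open>P\<^sub>k \<rho> P\<^sub>l\<close> of an invariant \<open>\<rho>\<close>
  satisfies a Sylvester equation with projections as coefficients and a dissipative constant, hence
  vanishes. The diagonal blocks give, by induction on \<open>k\<close>, the intertwining relation
  \<open>\<rho> Z\<^sub>k = e\<^bsup>\<beta>_k\<^esup> Z\<^sub>k \<rho>\<close>; conversely, block diagonal operators with this relation are invariant.

  Let \<open>m + 1\<close> be the highest site not annihilated by \<open>\<rho>\<close>, \<open>x \<in> E\<^bsub>m+1\<^esub>\<close> with \<open>\<rho> x \<noteq> 0\<close>, and
  \<open>w\<^sub>j = \<rho> Z\<^sup>*\<^bsup>m-j\<^esup> x\<close>. By the intertwining relation, \<open>w\<^sub>j\<close> is a multiple of \<open>Z\<^sup>j w\<^sub>0\<close>, and the weighted sum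
  \<open>\<sigma>\<close> of the \<open>|w\<^sub>j\<rangle>\<langle>w\<^sub>j|\<close> is invariant. The Cauchy--Schwarz inequality for \<open>\<rho>\<close> on each site bounds \<open>\<sigma>\<close> by a
  multiple of \<open>\<rho>\<close>, so extremality forces \<open>\<rho>\<close> to be proportional to \<open>\<sigma>\<close>. The first alternative is the
  case \<open>m = 0\<close>; for \<open>m > 0\<close> the vector \<open>w\<^sub>0\<close> lies in the range of \<open>Z\<^sub>1\<^sup>*\<close>, which is orthogonal to \<open>W\<close>.
\<close>

section \<open>Matrices over a finite set of labels\<close>

lemma sum_fun_app: "(\<Sum>x\<in>S. f x) i = (\<Sum>x\<in>S. f x i)"
  by (induction S rule: infinite_finite_induct) auto

lemma mm_assoc:
  assumes "finite L" shows "mm L (mm L A B) C = mm L A (mm L B C)"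
  unfolding mm_def sum_distrib_left sum_distrib_right
  by (intro ext) (subst sum.swap, simp add: mult.assoc)

lemma mm_add_left: "mm L (A + B) C = mm L A C + mm L B C"
  by (intro ext) (simp add: mm_def sum.distrib distrib_right)
lemma mm_add_right: "mm L A (B + C) = mm L A B + mm L A C"
  by (intro ext) (simp add: mm_def sum.distrib distrib_left)
lemma mm_diff_left: "mm L (A - B) C = mm L A C - mm L B C"
  by (intro ext) (simp add: mm_def sum_subtractf left_diff_distrib)
lemma mm_diff_right: "mm L A (B - C) = mm L A B - mm L A C"
  by (intro ext) (simp add: mm_def sum_subtractf right_diff_distrib)
lemma mm_smul_left: "mm L (smul c A) B = smul c (mm L A B)"
  by (intro ext) (simp add: mm_def smul_def sum_distrib_left mult.assoc)
lemma mm_smul_right: "mm L A (smul c B) = smul c (mm L A B)"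
  by (intro ext) (simp add: mm_def smul_def sum_distrib_left mult_ac)
lemma mm_0_left: "mm L 0 A = 0"
  by (intro ext) (simp add: mm_def)
lemma mm_0_right: "mm L A 0 = 0"
  by (intro ext) (simp add: mm_def)
lemma mm_sum_left: "mm L (sum F S) A = (\<Sum>x\<in>S. mm L (F x) A)"
  by (intro ext) (simp add: mm_def sum_fun_app sum_distrib_right sum.swap[of _ S])
lemma mm_sum_right: "mm L A (sum F S) = (\<Sum>x\<in>S. mm L A (F x))"
  by (intro ext) (simp add: mm_def sum_fun_app sum_distrib_left sum.swap[of _ S])

lemma smul_smul: "smul a (smul b A) = smul (a * b) A"
  by (simp add: smul_def mult.assoc)
lemma smul_0: "smul a 0 = 0" "smul 0 A = 0"
  by (auto simp: smul_def fun_eq_iff)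
lemma smul_1: "smul 1 A = A"
  by (simp add: smul_def)
lemma smul_add: "smul a (A + B) = smul a A + smul a B"
  by (auto simp: smul_def fun_eq_iff distrib_left)
lemma smul_plus: "smul (a + b) A = smul a A + smul b A"
  by (auto simp: smul_def fun_eq_iff distrib_right)
lemma smul_diff: "smul a (A - B) = smul a A - smul a B"
  by (auto simp: smul_def fun_eq_iff right_diff_distrib)
lemma smul_sum: "smul a (sum F S) = (\<Sum>x\<in>S. smul a (F x))"
  by (intro ext) (simp add: smul_def sum_fun_app sum_distrib_left)
lemma smul_eq_0: "smul a A = 0 \<Longrightarrow> a \<noteq> 0 \<Longrightarrow> A = 0"
  by (auto simp: smul_def fun_eq_iff)

lemmas mm_linear = mm_add_left mm_add_right mm_diff_left mm_diff_right mm_smul_left mm_smul_right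
  mm_0_left mm_0_right mm_sum_left mm_sum_right

lemma adj_mm: "adj (mm L A B) = mm L (adj B) (adj A)"
  by (intro ext) (simp add: adj_def mm_def mult.commute)
lemma adj_adj: "adj (adj A) = A"
  by (simp add: adj_def)
lemma adj_smul: "adj (smul c A) = smul (cnj c) (adj A)"
  by (simp add: adj_def smul_def)
lemma adj_outer: "adj (outer u v) = outer v u"
  by (simp add: adj_def outer_def mult.commute)
lemma adj_0: "adj 0 = 0"
  by (auto simp: adj_def fun_eq_iff)
lemma adj_sum: "adj (sum F S) = (\<Sum>x\<in>S. adj (F x))"
  by (intro ext) (simp add: adj_def sum_fun_app)

lemma mm_outer_right: "mm L A (outer u v) = outer (app L A u) v"
  by (intro ext) (simp add: mm_def outer_def app_def sum_distrib_right mult.assoc)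
lemma mm_outer_left: "mm L (outer u v) A = outer u (app L (adj A) v)"
  by (intro ext) (simp add: mm_def outer_def app_def adj_def sum_distrib_left mult_ac)
lemma outer_0: "outer 0 v = 0" "outer u 0 = 0"
  by (auto simp: outer_def fun_eq_iff)

definition vscale :: "complex \<Rightarrow> lvec \<Rightarrow> lvec" where
  "vscale c v = (\<lambda>i. c * v i)"

lemma outer_vscale: "outer (vscale a u) (vscale b v) = smul (a * cnj b) (outer u v)"
  by (simp add: outer_def vscale_def smul_def mult_ac)

lemma app_mm: "finite L \<Longrightarrow> app L (mm L A B) v = app L A (app L B v)"
  unfolding mm_def app_def sum_distrib_left sum_distrib_right
  by (intro ext, subst sum.swap) (simp add: mult.assoc)
lemma app_0: "app L A 0 = 0" "app L 0 v = 0"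
  by (auto simp: app_def fun_eq_iff)
lemma app_diff_left: "app L (A - B) v = app L A v - app L B v"
  by (intro ext) (simp add: app_def sum_subtractf left_diff_distrib)
lemma app_add_right: "app L A (u + v) = app L A u + app L A v"
  by (intro ext) (simp add: app_def sum.distrib distrib_left)
lemma app_smul: "app L (smul c A) v = vscale c (app L A v)"
  by (intro ext) (simp add: app_def smul_def vscale_def sum_distrib_left mult.assoc)
lemma app_vscale: "app L A (vscale c v) = vscale c (app L A v)"
  by (intro ext) (simp add: app_def vscale_def sum_distrib_left mult_ac)
lemma app_sum_left: "app L (sum F S) v = (\<Sum>x\<in>S. app L (F x) v)"
  by (intro ext) (simp add: app_def sum_fun_app sum_distrib_right sum.swap[of _ S])
lemma app_outer: "app L (outer u v) w = vscale (inner L v w) u"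
  by (intro ext) (simp add: app_def outer_def vscale_def inner_def sum_distrib_left mult_ac)
lemma vscale_vscale: "vscale a (vscale b v) = vscale (a * b) v"
  by (simp add: vscale_def mult.assoc)
lemma vscale_0: "vscale 0 v = 0" "vscale a 0 = 0"
  by (auto simp: vscale_def fun_eq_iff)
lemma vscale_1: "vscale 1 v = v"
  by (simp add: vscale_def)

lemma inner_app: "inner L u (app L A v) = inner L (app L (adj A) u) v"
  unfolding inner_def app_def adj_def cnj_sum sum_distrib_left sum_distrib_right complex_cnj_mult
  by (subst sum.swap) (simp add: mult_ac)
lemma inner_commute: "inner L u v = cnj (inner L v u)"
  by (simp add: inner_def mult.commute)
lemma inner_0: "inner L 0 v = 0" "inner L v 0 = 0"
  by (auto simp: inner_def)
lemma inner_vscale: "inner L u (vscale c v) = c * inner L u v" "inner L (vscale c u) v = cnj c * inner L u v"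
  by (auto simp: inner_def vscale_def sum_distrib_left mult_ac)
lemma inner_add: "inner L u (v + w) = inner L u v + inner L u w" "inner L (v + w) u = inner L v u + inner L w u"
  by (auto simp: inner_def sum.distrib algebra_simps)
lemma inner_diff: "inner L u (v - w) = inner L u v - inner L u w"
  by (auto simp: inner_def sum_subtractf algebra_simps)
lemma inner_sum: "inner L u (sum F S) = (\<Sum>x\<in>S. inner L u (F x))"
  by (simp add: inner_def sum_fun_app sum_distrib_left sum.swap[of _ S])

lemma inner_ket: "finite L \<Longrightarrow> i \<in> L \<Longrightarrow> inner L (ket i) v = v i"
  by (simp add: inner_def ket_def if_distrib if_distribR sum.delta cong: if_cong)

lemma ket_vecs: "i \<in> L \<Longrightarrow> ket i \<in> vecs L"
  by (auto simp: vecs_def ket_def)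

lemma inner_eq_0_imp:
  assumes "finite L" "v \<in> vecs L" "\<And>w. w \<in> vecs L \<Longrightarrow> inner L w v = 0" shows "v = 0"
proof
  fix i
  show "v i = 0 i" using assms inner_ket[of L i v] ket_vecs[of i L]
    by (cases "i \<in> L") (auto simp: vecs_def)
qed

lemma app_ket: "finite L \<Longrightarrow> i \<in> L \<Longrightarrow> app L A (ket i) = (\<lambda>j. A j i)"
  by (simp add: app_def ket_def if_distrib if_distribR sum.delta cong: if_cong)

lemma app_vecs: "A \<in> ops L \<Longrightarrow> app L A v \<in> vecs L"
  by (auto simp: vecs_def ops_def app_def)

lemma vecs_add: "u \<in> vecs L \<Longrightarrow> v \<in> vecs L \<Longrightarrow> u + v \<in> vecs L"
  and vecs_vscale: "u \<in> vecs L \<Longrightarrow> vscale c u \<in> vecs L"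
  by (auto simp: vecs_def vscale_def)

text \<open>Compressing the equation by \<open>Q\<close> and \<open>R\<close> on both sides, then on
  one side at a time, kills \<open>QXR\<close>, \<open>QX\<close>, \<open>XR\<close> and finally
  \<open>X\<close>. The scalars met on the way are \<open>a + b + c\<close>, \<open>a + c\<close>,
  \<open>b + c\<close> and \<open>c\<close>, all of positive real part.\<close>

lemma idempotent_sylvester_zero:
  assumes fin: "finite L" and Q: "mm L Q Q = Q" and R: "mm L R R = R"
    and eq: "smul a (mm L Q X) + smul b (mm L X R) + smul c X = 0"
    and "Re a \<ge> 0" "Re b \<ge> 0" "Re c > 0"
  shows "X = 0"
proof -
  note [simp] = mm_linear mm_0_left mm_0_right mm_assoc[OF fin] smul_0 R
  have QQ: "mm L Q (mm L Q B) = mm L Q B" for B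
    using Q mm_assoc[OF fin, of Q Q B] by simp
  have nz: "a + b + c \<noteq> 0" "a + c \<noteq> 0" "b + c \<noteq> 0" "c \<noteq> 0"
    using assms by (auto simp: complex_eq_iff)
  have "mm L Q (mm L (smul a (mm L Q X) + smul b (mm L X R) + smul c X) R) = 0"
    by (simp add: eq)
  then have "smul (a + b + c) (mm L Q (mm L X R)) = 0"
    by (simp add: QQ smul_plus ac_simps)
  then have 1: "mm L Q (mm L X R) = 0" using nz smul_eq_0 by blast
  have "mm L Q (smul a (mm L Q X) + smul b (mm L X R) + smul c X) = 0"
    by (simp add: eq)
  then have "smul (a + c) (mm L Q X) = 0"
    by (simp add: QQ 1 smul_plus ac_simps)
  then have 2: "mm L Q X = 0" using nz smul_eq_0 by blast
  have "mm L (smul a (mm L Q X) + smul b (mm L X R) + smul c X) R = 0"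
    by (simp add: eq)
  then have "smul (b + c) (mm L X R) = 0"
    by (simp add: 2 smul_plus ac_simps)
  then have 3: "mm L X R = 0" using nz smul_eq_0 by blast
  show ?thesis using eq nz smul_eq_0[of c X] by (simp add: 2 3)
qed

section \<open>Positive operators: self-adjointness, Cauchy-Schwarz, trace\<close>

lemma positive_op_real:
  assumes "positive_op L A" "v \<in> vecs L"
  shows "inner L v (app L A v) = of_real (Re (inner L v (app L A v)))"
    "Re (inner L v (app L A v)) \<ge> 0"
  using assms by (auto simp: positive_op_def complex_eq_iff)

lemma positive_op_hermitian:
  assumes fin: "finite L" and pos: "positive_op L A"
  shows "adj A = A"
proof (intro ext)
  fix i j
  have ops: "A \<in> ops L" using pos by (simp add: positive_op_def)
  show "adj A i j = A i j"
  proof (cases "i \<in> L \<and> j \<in> L")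
    case True
    have q: "inner L (vscale c (ket i) + ket j) (app L A (vscale c (ket i) + ket j))
        = cnj c * c * A i i + cnj c * A i j + c * A j i + A j j" for c
      using True fin
      by (simp add: inner_add inner_vscale app_add_right app_vscale inner_ket app_ket algebra_simps)
    have "Im (cnj c * c * A i i + cnj c * A i j + c * A j i + A j j) = 0" for c
      using pos True unfolding q[symmetric] positive_op_def
      by (simp add: vecs_add vecs_vscale ket_vecs)
    \<comment> \<open>Polarization: \<open>1\<close> and \<open>-1\<close> compare the imaginary
      parts of the two off-diagonal entries, the other two values their real parts.\<close>
    from this[of 1] this[of "-1"] this[of "\<i>"] this[of "-\<i>"]
    show ?thesis by (simp add: adj_def complex_eq_iff)
  next
    case False
    then show ?thesis using ops by (auto simp: ops_def adj_def)
  qed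
qed

text \<open>The form is only semidefinite, so the usual argument is run on
  \<open>r v - t b u\<close> with two free real parameters, which also covers a null vector
  \<open>u\<close>.\<close>

lemma positive_op_cauchy_schwarz:
  assumes fin: "finite L" and pos: "positive_op L A" and u: "u \<in> vecs L" and v: "v \<in> vecs L"
  shows "(cmod (inner L u (app L A v)))\<^sup>2
     \<le> Re (inner L u (app L A u)) * Re (inner L v (app L A v))"
proof -
  define a where "a = Re (inner L u (app L A u))"
  define d where "d = Re (inner L v (app L A v))"
  define b where "b = inner L u (app L A v)"
  have h: "adj A = A" using positive_op_hermitian[OF fin pos] .
  have a: "inner L u (app L A u) = of_real a" "a \<ge> 0"
    using positive_op_real[OF pos u] by (auto simp: a_def)
  have d: "inner L v (app L A v) = of_real d" "d \<ge> 0"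
    using positive_op_real[OF pos v] by (auto simp: d_def)
  have b': "inner L v (app L A u) = cnj b"
    by (subst inner_commute) (simp add: b_def inner_app h)
  have bb: "b * cnj b = of_real ((cmod b)\<^sup>2)"
    by (metis complex_norm_square of_real_power)
  have q: "Re (inner L w (app L A w)) = r\<^sup>2 * d - 2 * r * t * (cmod b)\<^sup>2 + t\<^sup>2 * (cmod b)\<^sup>2 * a"
    if "w = vscale (of_real r) v + vscale (- of_real t * b) u" for r t w
  proof -
    have "inner L w (app L A w) = of_real (r\<^sup>2) * of_real d - 2 * of_real (r * t) * (b * cnj b) + of_real (t\<^sup>2) * (b * cnj b) * of_real a"
      unfolding that by (simp add: inner_add inner_vscale app_add_right app_vscale a d b' b_def[symmetric]
        power2_eq_square) (simp add: algebra_simps)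
    also have "\<dots> = of_real (r\<^sup>2 * d - 2 * r * t * (cmod b)\<^sup>2 + t\<^sup>2 * (cmod b)\<^sup>2 * a)"
      unfolding bb by simp
    finally show ?thesis by (simp only: Re_complex_of_real)
  qed
  have nn: "r\<^sup>2 * d - 2 * r * t * (cmod b)\<^sup>2 + t\<^sup>2 * (cmod b)\<^sup>2 * a \<ge> 0" for r t
    unfolding q[OF refl, symmetric]
    using positive_op_real(2)[OF pos] u v by (simp add: vecs_add vecs_vscale)
  have "(cmod b)\<^sup>2 \<le> a * d"
  proof (cases "a = 0")
    case True
    have "(cmod b)\<^sup>2 = 0"
    proof (rule ccontr)
      assume "(cmod b)\<^sup>2 \<noteq> 0"
      \<comment> \<open>With \<open>a = 0\<close> the expression is \<open>d - 2 t |b|^2\<close>;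
        this \<open>t\<close> makes it equal to \<open>-1\<close>.\<close>
      then show False using nn[of 1 "(d + 1) / (2 * (cmod b)\<^sup>2)"] True d(2) by (simp add: field_simps)
    qed
    then show ?thesis using True by simp
  next
    case False
    then have "a > 0" using a by simp
    have "a * (a * d - (cmod b)\<^sup>2) \<ge> 0"
      using nn[of a 1] by (simp add: power2_eq_square algebra_simps)
    then show ?thesis using \<open>a > 0\<close> by (simp add: zero_le_mult_iff)
  qed
  then show ?thesis by (simp add: a_def b_def d_def)
qed

text \<open>By Cauchy-Schwarz a vector of zero expectation has an image orthogonal to everything, so
  it lies in the kernel.\<close>

lemma positive_op_pos:
  assumes fin: "finite L" and pos: "positive_op L A" and v: "v \<in> vecs L" and nz: "app L A v \<noteq> 0"
  shows "Re (inner L v (app L A v)) > 0"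
proof (rule ccontr)
  assume "\<not> ?thesis"
  then have 0: "Re (inner L v (app L A v)) = 0"
    using positive_op_real(2)[OF pos v] by simp
  have "inner L w (app L A v) = 0" if "w \<in> vecs L" for w
    using positive_op_cauchy_schwarz[OF fin pos that v] by (simp add: 0)
  moreover have "app L A v \<in> vecs L" using pos by (simp add: positive_op_def app_vecs)
  ultimately show False using inner_eq_0_imp[OF fin] nz by blast
qed

lemma positive_op_trace:
  assumes fin: "finite L" and pos: "positive_op L A"
  shows "tr L A = of_real (Re (tr L A))" "Re (tr L A) \<ge> 0" "A \<noteq> 0 \<Longrightarrow> Re (tr L A) > 0"
proof -
  have diag: "A i i = inner L (ket i) (app L A (ket i))" if "i \<in> L" for i
    using that fin by (simp add: inner_ket app_ket)
  have re: "A i i = of_real (Re (A i i))" "Re (A i i) \<ge> 0" if "i \<in> L" for i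
    using positive_op_real[OF pos ket_vecs[OF that]] diag[OF that] by auto
  show "tr L A = of_real (Re (tr L A))"
    unfolding tr_def Re_sum of_real_sum by (rule sum.cong) (use re in auto)
  show "Re (tr L A) \<ge> 0"
    unfolding tr_def Re_sum by (rule sum_nonneg) (use re in auto)
  assume "A \<noteq> 0"
  then obtain i j where ij: "A i j \<noteq> 0" by (auto simp: fun_eq_iff)
  with pos have L: "i \<in> L" "j \<in> L" by (auto simp: positive_op_def ops_def)
  \<comment> \<open>A nonzero entry in column \<open>j\<close> makes the diagonal entry at
    \<open>j\<close> strictly positive.\<close>
  have "app L A (ket j) \<noteq> 0" using ij L fin by (auto simp: app_ket fun_eq_iff)
  from positive_op_pos[OF fin pos ket_vecs[OF L(2)] this] have "Re (A j j) > 0"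
    using diag[OF L(2)] by simp
  then show "Re (tr L A) > 0"
    unfolding tr_def Re_sum using fin L re by (intro sum_pos2[of _ j]) auto
qed

lemma positive_op_smul:
  assumes "positive_op L A" "r \<ge> 0" shows "positive_op L (smul (of_real r) A)"
  using assms by (auto simp: positive_op_def app_smul inner_vscale) (auto simp: ops_def smul_def)

lemma tr_add: "tr L (A + B) = tr L A + tr L B" and tr_smul: "tr L (smul c A) = c * tr L A"
  by (auto simp: tr_def sum.distrib smul_def sum_distrib_left)

section \<open>Linearity of the generator and extremality of invariant states\<close>

lemma gen_smul: "gen N n Gm Gp gm gp (smul c A) = smul c (gen N n Gm Gp gm gp A)"
  unfolding gen_def Let_def
  by (simp add: mm_linear smul_add smul_diff smul_sum smul_smul mult.commute)

lemma gen_diff: "gen N n Gm Gp gm gp (A - B) = gen N n Gm Gp gm gp A - gen N n Gm Gp gm gp B"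
  unfolding gen_def Let_def
  by (simp add: mm_linear smul_add smul_diff smul_sum smul_smul sum.distrib sum_subtractf algebra_simps)

text \<open>An invariant operator below the state splits it into the normalized operator and the
  normalized remainder, with weights \<open>s\<close> and \<open>1 - s\<close>, where
  \<open>s\<close> is the trace of \<open>\<sigma>\<close>. Extremality identifies the two
  parts.\<close>

lemma extremal_dominated:
  assumes fin: "finite (lbls N n)" and ext: "invariant_extremal N n Gm Gp gm gp \<rho>"
    and pos: "positive_op (lbls N n) \<sigma>" "positive_op (lbls N n) (\<rho> - \<sigma>)"
    and inv: "gen N n Gm Gp gm gp \<sigma> = 0" and nz: "\<sigma> \<noteq> 0"
  shows "\<exists>t>0. \<rho> = smul (of_real t) \<sigma>"
\<comment> \<open>If the two coincide, the remainder has trace zero and cannot be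
  normalized.\<close>
proof (cases "\<rho> = \<sigma>")
  case True
  then show ?thesis by (intro exI[of _ 1]) (simp add: smul_1)
next
  case False
  define L where "L = lbls N n"
  define s where "s = Re (tr L \<sigma>)"
  have s: "tr L \<sigma> = of_real s" "s > 0"
    using positive_op_trace[OF fin pos(1)] nz by (auto simp: s_def L_def)
  have r: "invariant_state N n Gm Gp gm gp \<rho>" using ext by (simp add: invariant_extremal_def)
  have tr1: "tr L \<rho> = 1" using r by (simp add: invariant_state_def is_state_def L_def)
  have "tr L \<rho> = tr L \<sigma> + tr L (\<rho> - \<sigma>)" by (simp add: tr_add[symmetric])
  then have t: "tr L (\<rho> - \<sigma>) = of_real (1 - s)" using tr1 s by (simp add: algebra_simps)
  have s1: "s < 1" using positive_op_trace(3)[OF fin pos(2)] False t by (simp add: L_def)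
  define \<sigma>1 where "\<sigma>1 = smul (of_real (1 / s)) \<sigma>"
  define \<sigma>2 where "\<sigma>2 = smul (of_real (1 / (1 - s))) (\<rho> - \<sigma>)"
  have gr: "gen N n Gm Gp gm gp \<rho> = 0" using r by (simp add: invariant_state_def zero_fun_def)
  have "invariant_state N n Gm Gp gm gp \<sigma>1"
    unfolding invariant_state_def is_state_def \<sigma>1_def
    using positive_op_smul[OF pos(1), of "1/s"] s inv
    by (simp add: tr_smul L_def gen_smul smul_0) (simp add: zero_fun_def)
  moreover have "invariant_state N n Gm Gp gm gp \<sigma>2"
    unfolding invariant_state_def is_state_def \<sigma>2_def
    using positive_op_smul[OF pos(2), of "1/(1-s)"] s1 t inv
    by (simp add: tr_smul L_def gen_smul gen_diff gr smul_0 del: of_real_divide of_real_diff)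
      (simp add: zero_fun_def)
  moreover have *: "\<rho> = smul (of_real s) \<sigma>1 + smul (of_real (1 - s)) \<sigma>2"
    using s s1 by (simp add: \<sigma>1_def \<sigma>2_def smul_smul smul_1 flip: of_real_mult)
  ultimately have "\<sigma>1 = \<sigma>2" using ext s s1 unfolding invariant_extremal_def by blast
  then have "\<rho> = \<sigma>1" using * by (auto simp: smul_def fun_eq_iff algebra_simps)
  then show ?thesis using s by (intro exI[of _ "1/s"]) (simp add: \<sigma>1_def)
qed

section \<open>Fourier orthogonality and the sites of the chain\<close>

lemma zeta_eq_cis: "zeta n k ^ b = cis (2 * pi * real b / real (n k))"
proof -
  have "zeta n k = cis (2 * pi / real (n k))"
    by (simp add: zeta_def cis_conv_exp mult_ac)
  then show ?thesis by (simp add: DeMoivre mult_ac)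
qed

text \<open>A geometric sum whose ratio is a root of unity of order dividing \<open>n k\<close>. The
  ratio differs from \<open>1\<close> for \<open>b\<close> and \<open>b'\<close> distinct, because
  both are below \<open>n k\<close>.\<close>

lemma zeta_orthogonal:
  assumes "b < n k" "b' < n k"
  shows "(\<Sum>a<n k. zeta n k ^ (b * a) * cnj (zeta n k ^ (b' * a))) = (if b = b' then of_nat (n k) else 0)"
proof -
  define w where "w = zeta n k ^ b * cnj (zeta n k ^ b')"
  have unit: "cnj (zeta n k ^ b) * zeta n k ^ b = 1" for b
    unfolding zeta_eq_cis cis_cnj cis_mult by simp
  have root: "(zeta n k ^ b) ^ n k = 1" for b
    unfolding zeta_eq_cis DeMoivre using assms(1) cis_multiple_2pi[of "real b"] by (simp add: mult_ac)
  have sum: "(\<Sum>a<n k. zeta n k ^ (b * a) * cnj (zeta n k ^ (b' * a))) = (\<Sum>a<n k. w ^ a)"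
    by (simp add: w_def power_mult power_mult_distrib)
  show ?thesis
  proof (cases "b = b'")
    case True
    then have "w = 1" using unit[of b] by (simp add: w_def mult.commute)
    then show ?thesis using sum True by simp
  next
    case False
    have "w \<noteq> 1"
    proof
      assume "w = 1"
      then have "zeta n k ^ b = zeta n k ^ b'"
        using unit[of b'] unfolding w_def by (metis mult.assoc mult.left_neutral mult.right_neutral)
      then have "cis (2 * pi * real b / real (n k)) = cis (2 * pi * real b' / real (n k))"
        by (simp only: zeta_eq_cis)
      moreover have "inj_on (\<lambda>b. cis (2 * pi * real b / real (n k))) {..<n k}"
        using bij_betw_roots_unity[of "n k"] assms by (auto simp: bij_betw_def)
      ultimately show False using assms False by (auto simp: inj_on_def)
    qed
    moreover have "w ^ n k = 1"
      unfolding w_def power_mult_distrib complex_cnj_power[symmetric] root by simp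
    ultimately have "(\<Sum>a<n k. w ^ a) = 0" using geometric_sum[of w "n k"] by simp
    then show ?thesis using sum False by simp
  qed
qed

text \<open>\<open>vecs (site n k)\<close> is the subspace E_k.\<close>

definition site :: "(nat \<Rightarrow> nat) \<Rightarrow> nat \<Rightarrow> lbl set" where
  "site n k = Bs k ` {..<n k}"

lemma site_disjoint: "i \<in> site n k \<Longrightarrow> i \<in> site n l \<Longrightarrow> k = l"
  by (auto simp: site_def)

lemma Pk_eq: "Pk n k i j = (if i = j \<and> i \<in> site n k then 1 else 0)"
  by (cases i) (auto simp: Pk_def site_def)

lemma Zk_nonzero: "Zk n k i j \<noteq> 0 \<Longrightarrow> i \<in> site n (Suc k) \<and> j \<in> site n k"
  by (cases i; cases j) (auto simp: Zk_def site_def split: if_splits)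

lemma adj_Pk: "adj (Pk n k) = Pk n k"
  by (auto simp: adj_def Pk_eq fun_eq_iff)

section \<open>The generator on operators supported away from the ends\<close>

locale transport_chain =
  fixes N :: nat and n :: "nat \<Rightarrow> nat" and Gm Gp gm gp :: "freq \<Rightarrow> real"
  assumes N2: "N \<ge> 2"
    and decreasing: "\<forall>k. 1 \<le> k \<and> k < N \<longrightarrow> n (k + 1) \<le> n k"
    and last_pos: "n N \<ge> 1"
    and rates_pos: "\<forall>w\<in>freqs N. Gm w > 0 \<and> Gp w > 0"
begin

abbreviation "L \<equiv> lbls N n"
abbreviation "P \<equiv> Pk n"
abbreviation "Z \<equiv> Zk n"
abbreviation "Z' k \<equiv> adj (Zk n k)"
abbreviation prod (infixr "\<odot>" 70) where "A \<odot> B \<equiv> mm (lbls N n) A B"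
abbreviation apply_op (infixr "\<cdot>" 75) where "A \<cdot> v \<equiv> app (lbls N n) A v"

lemma L_eq: "L = {Mn, Pl} \<union> (\<Union>k\<in>{1..N}. site n k)"
  by (auto simp: lbls_def site_def)

lemma fin: "finite L"
  unfolding L_eq by (auto simp: site_def)

lemma site_L: "1 \<le> k \<Longrightarrow> k \<le> N \<Longrightarrow> i \<in> site n k \<Longrightarrow> i \<in> L"
  by (auto simp: L_eq)

lemma n_pos: "1 \<le> k \<Longrightarrow> k \<le> N \<Longrightarrow> n k \<ge> 1"
proof (induction "N - k" arbitrary: k)
  case 0
  then show ?case using last_pos by auto
next
  case (Suc d)
  then have "n (Suc k) \<ge> 1" by (intro Suc(1)) auto
  then show ?case using decreasing Suc(2-4) by (metis Suc_eq_plus1 dual_order.trans le_neq_implies_less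
    diff_self_eq_0 nat.distinct(1))
qed

lemma Gm_pos: "1 \<le> k \<Longrightarrow> k < N \<Longrightarrow> Gm (Wk k) > 0" and Gp_pos: "1 \<le> k \<Longrightarrow> k < N \<Longrightarrow> Gp (Wk k) > 0"
  using rates_pos by (auto simp: freqs_def)

lemma P_left: "1 \<le> k \<Longrightarrow> k \<le> N \<Longrightarrow> (P k \<odot> A) i j = (if i \<in> site n k then A i j else 0)"
  using fin site_L[of k i] by (auto simp: mm_def Pk_eq if_distrib if_distribR sum.delta cong: if_cong)

lemma P_right: "1 \<le> k \<Longrightarrow> k \<le> N \<Longrightarrow> (A \<odot> P k) i j = (if j \<in> site n k then A i j else 0)"
proof -
  assume k: "1 \<le> k" "k \<le> N"
  have "A \<odot> P k = adj (P k \<odot> adj A)"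
    by (simp only: adj_mm adj_adj adj_Pk)
  then show ?thesis by (simp add: P_left[OF k] adj_def)
qed

lemma P_Z: "1 \<le> k \<Longrightarrow> k \<le> N \<Longrightarrow> P k \<odot> Z j = (if k = Suc j then Z j else 0)"
  and Z_P: "1 \<le> k \<Longrightarrow> k \<le> N \<Longrightarrow> Z j \<odot> P k = (if j = k then Z j else 0)"
  and P_P: "1 \<le> k \<Longrightarrow> k \<le> N \<Longrightarrow> P k \<odot> P l = (if k = l then P k else 0)"
  by (auto simp: fun_eq_iff P_left P_right Pk_eq dest: Zk_nonzero site_disjoint)

lemma P_Z': "1 \<le> k \<Longrightarrow> k \<le> N \<Longrightarrow> P k \<odot> Z' j = (if j = k then Z' j else 0)"
  and Z'_P: "1 \<le> k \<Longrightarrow> k \<le> N \<Longrightarrow> Z' j \<odot> P k = (if k = Suc j then Z' j else 0)"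
  using Z_P[of k j] P_Z[of k j] adj_mm[of L "P k" "Z j"] adj_mm[of L "Z j" "P k"]
  by (auto simp: adj_Pk adj_0)

text \<open>The rows of \<open>Z k\<close> are the first \<open>n (Suc k)\<close> rows of the
  unitary Fourier matrix of size \<open>n k\<close>. Taking rows without repetition is possible
  because \<open>n\<close> decreases along the chain.\<close>

lemma Z_Z': assumes k: "1 \<le> k" "k < N" shows "Z k \<odot> Z' k = P (Suc k)"
proof (intro ext)
  fix i j
  show "(Z k \<odot> Z' k) i j = P (Suc k) i j"
  proof (cases "i \<in> site n (Suc k) \<and> j \<in> site n (Suc k)")
    case False
    have "(Z k \<odot> Z' k) i j = 0"
      unfolding mm_def adj_def using False Zk_nonzero[of n k]
      by (intro sum.neutral) (metis complex_cnj_zero mult_zero_left mult_zero_right)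
    then show ?thesis using False by (auto simp: Pk_eq)
  next
    case True
    then obtain b b' where b: "i = Bs (Suc k) b" "b < n (Suc k)" "j = Bs (Suc k) b'" "b' < n (Suc k)"
      by (auto simp: site_def)
    have le: "n (Suc k) \<le> n k" using decreasing k by simp
    have "(Z k \<odot> Z' k) i j = (\<Sum>l\<in>site n k. Z k i l * cnj (Z k j l))"
      unfolding mm_def adj_def
      by (rule sum.mono_neutral_right) (use fin k site_L Zk_nonzero in \<open>auto\<close>)
    also have "\<dots> = (\<Sum>a<n k. Z k i (Bs k a) * cnj (Z k j (Bs k a)))"
      unfolding site_def by (subst sum.reindex) (auto simp: inj_on_def)
    also have "\<dots> = (\<Sum>a<n k. zeta n k ^ (b * a) * cnj (zeta n k ^ (b' * a)) / of_nat (n k))"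
    proof (rule sum.cong[OF refl])
      fix a assume "a \<in> {..<n k}"
      have "complex_of_real (sqrt (real (n k))) * complex_of_real (sqrt (real (n k))) = of_nat (n k)"
        unfolding of_real_mult[symmetric] by simp
      then show "Z k i (Bs k a) * cnj (Z k j (Bs k a))
        = zeta n k ^ (b * a) * cnj (zeta n k ^ (b' * a)) / of_nat (n k)"
        using b \<open>a \<in> _\<close> by (simp add: Zk_def)
    qed
    also have "\<dots> = (if b = b' then 1 else 0)"
      unfolding sum_divide_distrib[symmetric] using b le n_pos[of k] k
      by (subst zeta_orthogonal) auto
    finally show ?thesis using b by (auto simp: Pk_eq site_def)
  qed
qed

text \<open>Dissipation and Hamiltonian combine into the complex rates \<open>\<Gamma>\<^sub>- / 2 + \<i> \<gamma>\<^sub>-\<close> and \<open>\<Gamma>\<^sub>+ / 2 - \<i> \<gamma>\<^sub>+\<close>.\<close>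
definition downrate :: "nat \<Rightarrow> complex" where "downrate k = Complex (Gm (Wk k) / 2) (gm (Wk k))"
definition uprate :: "nat \<Rightarrow> complex" where "uprate k = Complex (Gp (Wk k) / 2) (- gp (Wk k))"

text \<open>The contribution of the frequency \<open>Wk k\<close>, Hamiltonian part included, with
  the product of \<open>Z k\<close> and its adjoint already replaced by the projection onto site
  \<open>k + 1\<close>.\<close>

definition link_gen :: "nat \<Rightarrow> lop \<Rightarrow> lop" where
  "link_gen k A = smul (of_real (Gm (Wk k))) (Z k \<odot> A \<odot> Z' k) + smul (of_real (Gp (Wk k))) (Z' k \<odot> A \<odot> Z k)
     - smul (downrate k) (Z' k \<odot> Z k \<odot> A) - smul (cnj (downrate k)) (A \<odot> Z' k \<odot> Z k)
     - smul (uprate k) (P (Suc k) \<odot> A) - smul (cnj (uprate k)) (A \<odot> P (Suc k))"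

text \<open>The four vectors are those on which the end Kraus operators and the end terms of
  \<open>Heff\<close> act. Together with self-adjointness, the products with these end terms vanish
  on either side.\<close>

definition bulk :: "lop \<Rightarrow> bool" where
  "bulk A \<longleftrightarrow> A \<in> ops L \<and> adj A = A \<and> A \<cdot> ket Mn = 0 \<and> A \<cdot> ket Pl = 0
     \<and> A \<cdot> phi n 1 0 = 0 \<and> A \<cdot> phi n N 0 = 0"

lemma bulk_outer:
  assumes "bulk A" "A \<cdot> v = 0"
  shows "outer u v \<odot> A = 0" "A \<odot> outer v u = 0" "A \<odot> outer v u \<odot> B = 0"
proof -
  show "outer u v \<odot> A = 0" "A \<odot> outer v u = 0"
    using assms by (auto simp: bulk_def mm_outer_left mm_outer_right outer_0)
  then show "A \<odot> outer v u \<odot> B = 0"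
    by (metis mm_assoc[OF fin] mm_0_left)
qed

lemma bulk_sites:
  assumes A: "bulk A" and nz: "A i j \<noteq> 0"
  obtains k l where "1 \<le> k" "k \<le> N" "1 \<le> l" "l \<le> N" "i \<in> site n k" "j \<in> site n l"
proof -
  have ij: "i \<in> L" "j \<in> L" using A nz by (auto simp: bulk_def ops_def)
  have "A \<cdot> ket Mn = 0" "A \<cdot> ket Pl = 0" using A by (auto simp: bulk_def)
  then have c: "A x Mn = 0" "A x Pl = 0" for x
    using fin by (auto simp: app_ket lbls_def fun_eq_iff)
  have r: "A x y = cnj (A y x)" for x y
    using A by (auto simp: bulk_def adj_def fun_eq_iff)
  have "i \<noteq> Mn" "i \<noteq> Pl" "j \<noteq> Mn" "j \<noteq> Pl" using nz c r[of i j] by auto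
  then show ?thesis using ij that by (auto simp: L_eq)
qed

lemma gen_bulk:
  assumes A: "bulk A"
  shows "gen N n Gm Gp gm gp A = (\<Sum>k\<in>{1..N-1}. link_gen k A)"
proof -
  have k: "A \<cdot> ket Mn = 0" "A \<cdot> ket Pl = 0" "A \<cdot> phi n 1 0 = 0" "A \<cdot> phi n N 0 = 0"
    using A by (auto simp: bulk_def)
  note o = bulk_outer[OF A k(1)] bulk_outer[OF A k(2)] bulk_outer[OF A k(3)] bulk_outer[OF A k(4)]
  define D where "D w e = (let K = kraus N n Gm Gp w e; KK = adj K \<odot> K in
           (K \<odot> A) \<odot> adj K - smul (1/2) (KK \<odot> A + A \<odot> KK))" for w e
  define H where "H = Heff N n gm gp"
  define h where "h = (\<Sum>k\<in>{1..N-1}. smul (of_real (gm (Wk k))) (Z' k \<odot> Z k) - smul (of_real (gp (Wk k))) (P (Suc k)))"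
  \<comment> \<open>Every end term of the Hamiltonian is an outer product of vectors in the kernel
    of \<open>A\<close>.\<close>
  have HA: "H \<odot> A = h \<odot> A" and AH: "A \<odot> H = A \<odot> h"
    by (simp_all add: H_def h_def Heff_def absZk_def Pplus_def Pminus_def mm_linear o smul_0 Suc_eq_plus1 del: One_nat_def)
  have D0: "D w e = 0" if "w = Wp \<or> w = Wm" for w e
    using that by (cases e) (auto simp: D_def Let_def kraus_def adj_smul adj_outer adj_0 mm_linear smul_0
       mm_assoc[OF fin] o mm_0_left mm_0_right zero_fun_def[symmetric] simp del: One_nat_def)
  have fr: "freqs N = insert Wp (insert Wm (Wk ` {1..N-1}))" by (auto simp: freqs_def)
  have "gen N n Gm Gp gm gp A = smul (- \<i>) (h \<odot> A - A \<odot> h) + (\<Sum>w\<in>freqs N. \<Sum>e\<in>{Neg, Pos}. D w e)"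
    unfolding HA[symmetric] AH[symmetric] by (simp add: gen_def Let_def D_def H_def)
  also have "(\<Sum>w\<in>freqs N. \<Sum>e\<in>{Neg, Pos}. D w e) = (\<Sum>k\<in>{1..N-1}. D (Wk k) Neg + D (Wk k) Pos)"
    unfolding fr by (subst sum.insert; simp add: D0 image_iff) (subst sum.reindex; simp add: inj_on_def)
  also have "smul (- \<i>) (h \<odot> A - A \<odot> h) + \<dots> = (\<Sum>k\<in>{1..N-1}. link_gen k A)"
    unfolding h_def mm_linear sum_subtractf[symmetric] smul_sum sum.distrib[symmetric]
  proof (rule sum.cong[OF refl])
    fix k assume k: "k \<in> {1..N-1}"
    then have kN: "1 \<le> k" "k < N" by auto
    have [simp]: "complex_of_real (sqrt x) * complex_of_real (sqrt x) = of_real x" if "0 < x" for x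
      using that by (simp flip: of_real_mult)
    have 1: "D (Wk k) Neg = smul (of_real (Gm (Wk k))) (Z k \<odot> A \<odot> Z' k)
        - smul (of_real (Gm (Wk k) / 2)) (Z' k \<odot> Z k \<odot> A + A \<odot> Z' k \<odot> Z k)"
      using Gm_pos[OF kN]
      by (simp add: D_def Let_def kraus_def adj_smul mm_linear smul_smul mm_assoc[OF fin] smul_add)
    have 2: "D (Wk k) Pos = smul (of_real (Gp (Wk k))) (Z' k \<odot> A \<odot> Z k)
        - smul (of_real (Gp (Wk k) / 2)) (P (Suc k) \<odot> A + A \<odot> P (Suc k))"
      using Gp_pos[OF kN] unfolding Z_Z'[OF kN, symmetric]
      by (simp add: D_def Let_def kraus_def adj_smul adj_adj mm_linear smul_smul mm_assoc[OF fin] smul_add)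
    have al: "downrate k = of_real (Gm (Wk k)/2) + \<i> * of_real (gm (Wk k))"
      "cnj (downrate k) = of_real (Gm (Wk k)/2) - \<i> * of_real (gm (Wk k))"
      "uprate k = of_real (Gp (Wk k)/2) - \<i> * of_real (gp (Wk k))"
      "cnj (uprate k) = of_real (Gp (Wk k)/2) + \<i> * of_real (gp (Wk k))"
      by (auto simp: downrate_def uprate_def complex_eq_iff)
    show "smul (- \<i>) (smul (of_real (gm (Wk k))) ((Z' k \<odot> Z k) \<odot> A) - smul (of_real (gp (Wk k))) (P (Suc k) \<odot> A)
       - (smul (of_real (gm (Wk k))) (A \<odot> Z' k \<odot> Z k) - smul (of_real (gp (Wk k))) (A \<odot> P (Suc k))))
       + (D (Wk k) Neg + D (Wk k) Pos) = link_gen k A"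
      unfolding 1 2 link_gen_def al mm_assoc[OF fin]
      by (intro ext) (simp add: smul_def algebra_simps)
  qed
  finally show ?thesis .
qed

section \<open>Invariance as detailed balance\<close>

text \<open>Block diagonality together with detailed balance on each link. For \<open>bulk\<close>
  operators this characterizes the kernel of the generator, by \<open>balanced_gen\<close> and
  \<open>gen_balanced\<close>.\<close>

definition balanced :: "lop \<Rightarrow> bool" where
  "balanced A \<longleftrightarrow> (\<forall>k\<in>{1..N}. P k \<odot> A = A \<odot> P k)
     \<and> (\<forall>k\<in>{1..N-1}. A \<odot> Z k = smul (of_real (exp (beta Gm Gp k))) (Z k \<odot> A))"

lemma exp_beta: "1 \<le> k \<Longrightarrow> k < N \<Longrightarrow> exp (beta Gm Gp k) = Gm (Wk k) / Gp (Wk k)"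
  using Gm_pos Gp_pos by (simp add: beta_def)

lemma bulk_adj_mm: "bulk A \<Longrightarrow> adj (A \<odot> B) = adj B \<odot> A" "bulk A \<Longrightarrow> adj (B \<odot> A) = A \<odot> adj B"
  by (auto simp: adj_mm bulk_def)

lemma prefix_mm: "A \<odot> B = C \<Longrightarrow> A \<odot> B \<odot> D = C \<odot> D"
  using mm_assoc[OF fin] by metis

text \<open>Detailed balance turns each gain term into the loss term at the opposite end of the
  link. As \<open>A\<close> commutes with both loss projections, each complex rate meets its
  conjugate, the Hamiltonian phases cancel and gain equals loss.\<close>

lemma link_gen_eq_0:
  assumes A: "bulk A" and k: "1 \<le> k" "k < N"
    and com: "P (Suc k) \<odot> A = A \<odot> P (Suc k)"
    and int: "A \<odot> Z k = smul (of_real (exp (beta Gm Gp k))) (Z k \<odot> A)"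
  shows "link_gen k A = 0"
proof -
  define c where "c = complex_of_real (exp (beta Gm Gp k))"
  have c: "c \<noteq> 0" "of_real (Gp (Wk k)) * c = of_real (Gm (Wk k))" "of_real (Gm (Wk k)) / c = of_real (Gp (Wk k))"
    using exp_beta[OF k] Gm_pos[OF k] Gp_pos[OF k] by (auto simp: c_def simp flip: of_real_mult of_real_divide)
  have int': "Z' k \<odot> A = smul c (A \<odot> Z' k)"
    using arg_cong[OF int, of adj] by (simp add: bulk_adj_mm[OF A] adj_smul c_def)
  have ZA: "Z k \<odot> A = smul (1 / c) (A \<odot> Z k)" and AZ': "A \<odot> Z' k = smul (1 / c) (Z' k \<odot> A)"
    unfolding int int' by (simp_all add: smul_smul smul_1 c c_def[symmetric])
  have 1: "smul (of_real (Gm (Wk k))) (Z k \<odot> A \<odot> Z' k) = smul (of_real (Gp (Wk k))) (A \<odot> P (Suc k))"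
    by (simp add: prefix_mm[OF ZA] mm_assoc[OF fin] Z_Z'[OF k] mm_linear smul_smul c)
  have 2: "smul (of_real (Gp (Wk k))) (Z' k \<odot> A \<odot> Z k) = smul (of_real (Gm (Wk k))) (Z' k \<odot> Z k \<odot> A)"
    by (simp add: int mm_linear smul_smul c c_def[symmetric])
  have 3: "A \<odot> Z' k \<odot> Z k = Z' k \<odot> Z k \<odot> A"
    by (simp add: prefix_mm[OF AZ'] mm_assoc[OF fin] mm_linear int smul_smul smul_1 c c_def[symmetric])
  have al: "cnj (downrate k) = of_real (Gm (Wk k)) - downrate k" "cnj (uprate k) = of_real (Gp (Wk k)) - uprate k"
    by (auto simp: downrate_def uprate_def complex_eq_iff)
  show ?thesis
    unfolding link_gen_def 1 2 3 com al by (auto simp: smul_def fun_eq_iff algebra_simps)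
qed

lemma balanced_gen: "bulk A \<Longrightarrow> balanced A \<Longrightarrow> gen N n Gm Gp gm gp A = 0"
  unfolding gen_bulk by (intro sum.neutral ballI link_gen_eq_0) (auto simp: balanced_def)

text \<open>Sandwiching the invariance equation between two different site projections removes the
  gain terms and leaves the equation of \<open>idempotent_sylvester_zero\<close> for the block
  \<open>X\<close>.\<close>

lemma coherence_eq_0:
  assumes A: "bulk A" and inv: "gen N n Gm Gp gm gp A = 0"
    and k: "1 \<le> k" "k \<le> N" and l: "1 \<le> l" "l \<le> N" and ne: "k \<noteq> l"
  shows "P k \<odot> A \<odot> P l = 0"
proof -
  define X where "X = P k \<odot> A \<odot> P l"
  \<comment> \<open>\<open>a\<close> and \<open>d\<close> are the complex rates of leaving a site
    towards higher and lower index. The zero defaults reflect that site \<open>N\<close> has no link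
    to a higher site and site \<open>1\<close> none to a lower one.\<close>
  define Q where "Q k = (if k < N then Z' k \<odot> Z k else 0)" for k
  define a where "a k = (if k < N then downrate k else 0)" for k
  define d where "d k = (if 2 \<le> k then uprate (k - 1) else 0)" for k
  have QQ: "1 \<le> k \<Longrightarrow> k \<le> N \<Longrightarrow> Q k \<odot> Q k = Q k" for k
    by (auto simp: Q_def mm_0_left mm_assoc[OF fin] prefix_mm[OF Z_Z'] P_Z)
  have link: "P k \<odot> link_gen j A \<odot> P l =
      - (if j = k then smul (a k) (Q k \<odot> X) else 0) - (if j = l then smul (cnj (a l)) (X \<odot> Q l) else 0)
      - (if j = k - 1 then smul (d k) X else 0) - (if j = l - 1 then smul (cnj (d l)) X else 0)"
    if "j \<in> {1..N-1}" for j
  proof -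
    have j: "1 \<le> j" "j < N" "j = k - 1 \<longleftrightarrow> k = Suc j" "j = l - 1 \<longleftrightarrow> l = Suc j"
      using that k l by auto
    note assoc = mm_assoc[OF fin]
    \<comment> \<open>A gain term of link \<open>j\<close> survives only if both projections belong
      to the same end of that link, which is excluded for distinct sites.\<close>
    have 1: "P k \<odot> (Z j \<odot> A \<odot> Z' j) \<odot> P l = 0" "P k \<odot> (Z' j \<odot> A \<odot> Z j) \<odot> P l = 0"
      unfolding assoc using ne
      by (auto simp: prefix_mm[OF P_Z[OF k]] prefix_mm[OF P_Z'[OF k]] Z_P[OF l] Z'_P[OF l] mm_0_left mm_0_right)
    have 2: "P k \<odot> (Z' j \<odot> Z j \<odot> A) \<odot> P l = (if j = k then Q k \<odot> X else 0)"
      unfolding assoc X_def using j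
      by (auto simp: prefix_mm[OF P_Z'[OF k]] Q_def assoc prefix_mm[OF Z_P[OF k]] mm_0_left)
    have 3: "P k \<odot> (A \<odot> Z' j \<odot> Z j) \<odot> P l = (if j = l then X \<odot> Q l else 0)"
      unfolding assoc X_def using j
      by (auto simp: Z_P[OF l] prefix_mm[OF P_Z'[OF l]] Q_def assoc mm_0_right)
    have 4: "P k \<odot> (P (Suc j) \<odot> A) \<odot> P l = (if k = Suc j then X else 0)"
      unfolding assoc X_def by (auto simp: prefix_mm[OF P_P[OF k]] mm_0_left)
    have 5: "P k \<odot> (A \<odot> P (Suc j)) \<odot> P l = (if l = Suc j then X else 0)"
      unfolding assoc X_def using P_P[of "Suc j" l] j by (auto simp: mm_0_right)
    have "P k \<odot> link_gen j A \<odot> P l =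
      - smul (downrate j) (if j = k then Q k \<odot> X else 0) - smul (cnj (downrate j)) (if j = l then X \<odot> Q l else 0)
      - smul (uprate j) (if k = Suc j then X else 0) - smul (cnj (uprate j)) (if l = Suc j then X else 0)"
      unfolding link_gen_def mm_diff_left mm_diff_right mm_add_left mm_add_right mm_smul_left mm_smul_right 1 2 3 4 5
      by (simp add: smul_0)
    then show ?thesis
      unfolding j(3,4) a_def d_def using j(1,2) by (auto simp: smul_0)
  qed
  have "0 = P k \<odot> (\<Sum>j\<in>{1..N-1}. link_gen j A) \<odot> P l"
    using inv by (simp add: gen_bulk[OF A] mm_0_left mm_0_right)
  also have "\<dots> = (\<Sum>j\<in>{1..N-1}. P k \<odot> link_gen j A \<odot> P l)"
    by (simp add: mm_linear)
  also note sum.cong[OF refl link]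
  also have "(\<Sum>j\<in>{1..N-1}. - (if j = k then smul (a k) (Q k \<odot> X) else 0) - (if j = l then smul (cnj (a l)) (X \<odot> Q l) else 0)
      - (if j = k - 1 then smul (d k) X else 0) - (if j = l - 1 then smul (cnj (d l)) X else 0))
     = - smul (a k) (Q k \<odot> X) - smul (cnj (a l)) (X \<odot> Q l) - smul (d k) X - smul (cnj (d l)) X"
    using k l by (auto simp: sum_subtractf sum_negf sum.delta a_def d_def Q_def mm_0_left mm_0_right smul_0)
  finally have "smul (a k) (Q k \<odot> X) + smul (cnj (a l)) (X \<odot> Q l) + smul (d k + cnj (d l)) X = 0"
    unfolding smul_plus by (simp add: algebra_simps eq_neg_iff_add_eq_0)
  moreover have "Re (a k) \<ge> 0" "Re (cnj (a l)) \<ge> 0"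
    using k l Gm_pos[of k] Gm_pos[of l] by (auto simp: a_def downrate_def)
  \<comment> \<open>Of two distinct sites at least one is not the first, so the constant coefficient
    has positive real part.\<close>
  moreover have "Re (d m) = (if 2 \<le> m then Gp (Wk (m - 1)) / 2 else 0)" for m
    by (simp add: d_def uprate_def)
  then have "Re (d k + cnj (d l)) > 0"
    using k l ne Gp_pos[of "k - 1"] Gp_pos[of "l - 1"] by (auto intro: add_pos_pos)
  ultimately show ?thesis
    using idempotent_sylvester_zero[OF fin QQ[OF k] QQ[OF l]] unfolding X_def by blast
qed

text \<open>The commutation part is the absence of coherences. The intertwining part goes up the
  chain: once the links below \<open>k\<close> are balanced, compressing invariance to site
  \<open>k\<close> isolates link \<open>k\<close>.\<close>

lemma gen_balanced:
  assumes A: "bulk A" and inv: "gen N n Gm Gp gm gp A = 0"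
  shows "balanced A"
proof -
  have com: "P k \<odot> A = A \<odot> P k" if k: "1 \<le> k" "k \<le> N" for k
  proof (intro ext)
    fix i j
    have "i \<in> site n k \<longleftrightarrow> j \<in> site n k" if nz: "A i j \<noteq> 0"
    proof -
      obtain r s where rs: "1 \<le> r" "r \<le> N" "1 \<le> s" "s \<le> N" "i \<in> site n r" "j \<in> site n s"
        using bulk_sites[OF A nz] .
      have "(P r \<odot> A \<odot> P s) i j = A i j"
        using rs by (simp add: P_left P_right)
      then have "r = s" using coherence_eq_0[OF A inv rs(1-4)] nz by (metis zero_fun_apply)
      then show ?thesis using rs site_disjoint by metis
    qed
    then show "(P k \<odot> A) i j = (A \<odot> P k) i j"
      by (cases "A i j = 0") (auto simp: P_left[OF k] P_right[OF k])
  qed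
  have "A \<odot> Z k = smul (of_real (exp (beta Gm Gp k))) (Z k \<odot> A)" if "1 \<le> k" "k < N" for k
    using that
  proof (induction k rule: less_induct)
    case (less k)
    define Q where "Q = Z' k \<odot> Z k"
    have k: "1 \<le> k" "k \<le> N" "k < N" "Suc k \<le> N" "1 \<le> Suc k" using less.prems by auto
    have [simp]: "Z' k \<odot> Z k \<odot> B = Q \<odot> B" for B by (simp add: Q_def mm_assoc[OF fin])
    have QZ': "Q \<odot> Z' k = Z' k" and ZQ: "Z k \<odot> Q = Z k"
      unfolding Q_def mm_assoc[OF fin] using k by (auto simp: Z_Z' prefix_mm[OF Z_Z'] P_Z Z'_P)
    have QQ: "Q \<odot> Q = Q" by (metis Q_def QZ' mm_assoc[OF fin])
    have Qh: "adj Q = Q" by (simp add: Q_def adj_mm adj_adj)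
    have PQ: "P k \<odot> Q = Q" unfolding Q_def using k by (simp add: prefix_mm[OF P_Z'])
    \<comment> \<open>Lower links vanish altogether by the induction hypothesis; higher links do not
      touch site \<open>k\<close>, once its projection has been moved through
      \<open>A\<close>.\<close>
    have "P k \<odot> link_gen j A = 0" if j: "j \<in> {1..N-1}" "j \<noteq> k" for j
    proof (cases "j < k")
      case True
      then have "link_gen j A = 0"
        using j k less.IH[of j] by (intro link_gen_eq_0[OF A] com) auto
      then show ?thesis by (simp add: mm_0_right)
    next
      case False
      then have j': "k \<noteq> Suc j" "j \<noteq> k" "1 \<le> j" "j < N" using j by auto
      note PA = prefix_mm[OF com[OF k(1,2)]]
      show ?thesis unfolding link_gen_def mm_linear PA mm_assoc[OF fin]
        using k j' by (simp add: prefix_mm[OF P_Z] prefix_mm[OF P_Z'] prefix_mm[OF P_P] P_P mm_0_left mm_0_right smul_0)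
    qed
    then have "(\<Sum>j\<in>{1..N-1}. P k \<odot> link_gen j A) = P k \<odot> link_gen k A"
      using k by (subst sum.remove[of _ k]) (auto intro: sum.neutral)
    then have "0 = P k \<odot> link_gen k A"
      using inv unfolding gen_bulk[OF A] mm_sum_right[symmetric] by (simp add: mm_0_right)
    also have "\<dots> = smul (of_real (Gp (Wk k))) (Z' k \<odot> A \<odot> Z k) - smul (downrate k) (Q \<odot> A) - smul (cnj (downrate k)) (A \<odot> Q)"
      unfolding link_gen_def mm_linear prefix_mm[OF com[OF k(1,2)]] mm_assoc[OF fin]
      using k by (simp add: prefix_mm[OF P_Z] prefix_mm[OF P_Z'] prefix_mm[OF P_P] P_P mm_0_left mm_0_right smul_0
         Q_def[symmetric] prefix_mm[OF PQ] PQ mm_assoc[OF fin])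
    finally have E: "smul (of_real (Gp (Wk k))) (Z' k \<odot> A \<odot> Z k) - smul (downrate k) (Q \<odot> A) - smul (cnj (downrate k)) (A \<odot> Q) = 0"
      by simp
    \<comment> \<open>Multiplying by \<open>Q\<close> on the left changes only the last term of
      \<open>E\<close>. Comparing the two equations gives \<open>AQ = QAQ\<close>, and taking
      adjoints shows that \<open>A\<close> commutes with \<open>Q\<close>.\<close>
    have "Q \<odot> (smul (of_real (Gp (Wk k))) (Z' k \<odot> A \<odot> Z k) - smul (downrate k) (Q \<odot> A) - smul (cnj (downrate k)) (A \<odot> Q)) = 0"
      unfolding E by (simp add: mm_0_right)
    then have "smul (of_real (Gp (Wk k))) (Z' k \<odot> A \<odot> Z k) - smul (downrate k) (Q \<odot> A) - smul (cnj (downrate k)) (Q \<odot> A \<odot> Q) = 0"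
      by (simp add: mm_linear prefix_mm[OF QZ'] prefix_mm[OF QQ])
    with E have "smul (cnj (downrate k)) (A \<odot> Q - Q \<odot> A \<odot> Q) = 0"
      by (simp add: smul_diff)
    moreover have al: "cnj (downrate k) \<noteq> 0" "downrate k + cnj (downrate k) = of_real (Gm (Wk k))"
      using Gm_pos[of k] k by (auto simp: downrate_def complex_eq_iff)
    ultimately have AQ: "A \<odot> Q = Q \<odot> A \<odot> Q" using smul_eq_0 by fastforce
    have "Q \<odot> A = Q \<odot> A \<odot> Q"
      using arg_cong[OF AQ, of adj] A by (simp add: bulk_def adj_mm Qh mm_assoc[OF fin])
    with AQ have "A \<odot> Q = Q \<odot> A" by simp
    \<comment> \<open>The commutation merges both loss terms, so that the Hamiltonian part of the
      rate drops out.\<close>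
    with E have "smul (of_real (Gp (Wk k))) (Z' k \<odot> A \<odot> Z k) = smul (of_real (Gm (Wk k))) (Q \<odot> A)"
      unfolding al(2)[symmetric] smul_plus by (simp add: algebra_simps)
    \<comment> \<open>Since \<open>Z k\<close> is a coisometry, multiplying by it on the left strips
      the adjoint and leaves the intertwining relation.\<close>
    from arg_cong[OF this, of "\<lambda>B. Z k \<odot> B"]
    have "smul (of_real (Gp (Wk k))) (P (Suc k) \<odot> A \<odot> Z k) = smul (of_real (Gm (Wk k))) (Z k \<odot> A)"
      using k by (simp add: mm_linear prefix_mm[OF Z_Z'] prefix_mm[OF ZQ])
    moreover have "P (Suc k) \<odot> A \<odot> Z k = A \<odot> Z k"
      using k by (simp add: prefix_mm[OF com] mm_assoc[OF fin] P_Z)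
    ultimately have "smul (1 / of_real (Gp (Wk k))) (smul (of_real (Gp (Wk k))) (A \<odot> Z k))
       = smul (1 / of_real (Gp (Wk k))) (smul (of_real (Gm (Wk k))) (Z k \<odot> A))" by simp
    then show ?case using Gp_pos[of k] k by (simp add: smul_smul smul_1 exp_beta)
  qed
  then show ?thesis using com by (auto simp: balanced_def)
qed

section \<open>The invariant operator generated by a vector\<close>

lemma site_vecs_L: "v \<in> vecs (site n k) \<Longrightarrow> 1 \<le> k \<Longrightarrow> k \<le> N \<Longrightarrow> v \<in> vecs L"
  using site_L by (auto simp: vecs_def)

lemma app_P_vecs: "P k \<cdot> v \<in> vecs (site n k)"
  by (auto simp: vecs_def app_def Pk_eq)

lemma app_P:
  assumes "v \<in> vecs (site n l)" "1 \<le> k" "k \<le> N" shows "P k \<cdot> v = (if k = l then v else 0)"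
proof
  fix i
  have "(P k \<cdot> v) i = (\<Sum>j\<in>L. if j = i then (if i \<in> site n k then v i else 0) else 0)"
    unfolding app_def Pk_eq by (rule sum.cong) auto
  also have "\<dots> = (if i \<in> site n k then v i else 0)"
    using fin site_L[OF assms(2,3)] by auto
  finally show "(P k \<cdot> v) i = (if k = l then v else 0) i"
    using assms(1) site_disjoint by (auto simp: vecs_def)
qed

lemma app_Z_vecs: "Z k \<cdot> v \<in> vecs (site n (Suc k))" and app_Z'_vecs: "Z' k \<cdot> v \<in> vecs (site n k)"
  unfolding vecs_def app_def adj_def by (auto intro!: sum.neutral) (use Zk_nonzero in blast)+

lemma app_Z_other: "v \<in> vecs (site n l) \<Longrightarrow> l \<noteq> k \<Longrightarrow> Z k \<cdot> v = 0"
  and app_Z'_other: "v \<in> vecs (site n l) \<Longrightarrow> l \<noteq> Suc k \<Longrightarrow> Z' k \<cdot> v = 0"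
  unfolding vecs_def app_def adj_def fun_eq_iff zero_fun_apply
  by (intro allI sum.neutral ballI; use Zk_nonzero site_disjoint in \<open>fastforce\<close>)+

lemma app_Zop:
  assumes "v \<in> vecs (site n l)" "1 \<le> l" "l \<le> N"
  shows "Zop N n \<cdot> v = (if l < N then Z l \<cdot> v else 0)"
    "adj (Zop N n) \<cdot> v = (if 2 \<le> l then Z' (l - 1) \<cdot> v else 0)"
proof -
  have "Zop N n \<cdot> v = (\<Sum>k\<in>{1..N-1}. if k = l then Z l \<cdot> v else 0)"
    unfolding Zop_def app_sum_left by (rule sum.cong) (use app_Z_other[OF assms(1)] in auto)
  then show "Zop N n \<cdot> v = (if l < N then Z l \<cdot> v else 0)"
    using assms by auto
  have "adj (Zop N n) \<cdot> v = (\<Sum>k\<in>{1..N-1}. if k = l - 1 then Z' (l - 1) \<cdot> v else 0)"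
    unfolding Zop_def adj_sum app_sum_left
    by (rule sum.cong) (use app_Z'_other[OF assms(1)] assms in \<open>auto split: if_splits\<close>)
  then show "adj (Zop N n) \<cdot> v = (if 2 \<le> l then Z' (l - 1) \<cdot> v else 0)"
    using assms by auto
qed

lemma phi_vecs: "phi n k a \<in> vecs (site n k)"
  by (auto simp: vecs_def phi_def site_def split: lbl.splits)

text \<open>For a self-adjoint operator, a range orthogonal to \<open>s\<close> means that
  \<open>s\<close> lies in the kernel.\<close>

lemma supported_bulk:
  assumes pos: "positive_op L A" and supp: "supported_on L A (Vsp N n)"
  shows "bulk A"
proof -
  have h: "adj A = A" and ops: "A \<in> ops L"
    using positive_op_hermitian[OF fin pos] pos by (auto simp: positive_op_def)
  have ker: "A \<cdot> s = 0" if s: "s \<in> Vexcl N n" "s \<in> vecs L" for s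
  proof (rule inner_eq_0_imp[OF fin app_vecs[OF ops]])
    fix w assume "w \<in> vecs L"
    then have "inner L s (A \<cdot> w) = 0"
      using supp s by (auto simp: supported_on_def Vsp_def orth_def)
    then have "inner L (A \<cdot> s) w = 0" by (simp add: inner_app h)
    then show "inner L w (A \<cdot> s) = 0" by (subst inner_commute) simp
  qed
  \<comment> \<open>The end vectors are the zeroth powers in the families defining
    \<open>Vexcl\<close>.\<close>
  have "Zpow N n 0 (phi n 1 0) \<in> Vexcl N n" "Zadjpow N n 0 (phi n N 0) \<in> Vexcl N n"
    "ket Mn \<in> Vexcl N n" "ket Pl \<in> Vexcl N n"
    unfolding Vexcl_def by blast+
  moreover have "phi n 1 0 \<in> vecs L" "phi n N 0 \<in> vecs L" "ket Mn \<in> vecs L" "ket Pl \<in> vecs L"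
    using N2 site_vecs_L[OF phi_vecs] by (auto intro!: ket_vecs simp: L_eq)
  ultimately show ?thesis
    using h ops ker by (auto simp: bulk_def Zpow_def Zadjpow_def)
qed

lemma app_Z_balanced:
  assumes "balanced A" "1 \<le> k" "k < N"
  shows "Z k \<cdot> A \<cdot> v = vscale (of_real (1 / exp (beta Gm Gp k))) (A \<cdot> Z k \<cdot> v)"
proof -
  have "A \<odot> Z k = smul (of_real (exp (beta Gm Gp k))) (Z k \<odot> A)"
    using assms by (auto simp: balanced_def)
  then have "A \<cdot> Z k \<cdot> v = vscale (of_real (exp (beta Gm Gp k))) (Z k \<cdot> A \<cdot> v)"
    by (metis app_mm[OF fin] app_smul)
  then show ?thesis by (simp add: vscale_vscale vscale_1)
qed

lemma app_Z'_balanced: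
  assumes "bulk A" "balanced A" "1 \<le> k" "k < N"
  shows "Z' k \<cdot> A \<cdot> v = vscale (of_real (exp (beta Gm Gp k))) (A \<cdot> Z' k \<cdot> v)"
proof -
  have "A \<odot> Z k = smul (of_real (exp (beta Gm Gp k))) (Z k \<odot> A)"
    using assms by (auto simp: balanced_def)
  then have "Z' k \<odot> A = smul (of_real (exp (beta Gm Gp k))) (A \<odot> Z' k)"
    using bulk_adj_mm[OF assms(1)] by (metis adj_smul complex_cnj_complex_of_real)
  then show ?thesis
    by (metis app_mm[OF fin] app_smul)
qed

lemma balanced_site_vecs:
  assumes "balanced A" "v \<in> vecs (site n k)" "1 \<le> k" "k \<le> N"
  shows "A \<cdot> v \<in> vecs (site n k)"
proof -
  have "P k \<odot> A = A \<odot> P k" using assms by (auto simp: balanced_def)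
  then have "P k \<cdot> A \<cdot> v = A \<cdot> P k \<cdot> v"
    by (metis app_mm[OF fin])
  then show ?thesis using assms app_P_vecs[of k "A \<cdot> v"] by (simp add: app_P)
qed

lemma balanced_inner_sum:
  assumes "bulk A" "balanced A"
  shows "inner L v (A \<cdot> v) = (\<Sum>j<N. inner L (P (Suc j) \<cdot> v) (A \<cdot> P (Suc j) \<cdot> v))"
proof -
  \<comment> \<open>Block diagonality: \<open>A\<close> is the sum of its diagonal blocks. Sites are
    numbered from 1, whence the shift.\<close>
  have "A = (\<Sum>j<N. P (Suc j) \<odot> A \<odot> P (Suc j))"
  proof (intro ext)
    fix i j
    have "(\<Sum>l<N. P (Suc l) \<odot> A \<odot> P (Suc l)) i j = (\<Sum>l<N. (P (Suc l) \<odot> A) i j)"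
      unfolding sum_fun_app
    proof (rule sum.cong[OF refl])
      fix l assume "l \<in> {..<N}"
      then have l: "1 \<le> Suc l" "Suc l \<le> N" by auto
      then have "P (Suc l) \<odot> A = A \<odot> P (Suc l)" using assms by (auto simp: balanced_def)
      then have "P (Suc l) \<odot> A \<odot> P (Suc l) = P (Suc l) \<odot> A"
        by (metis P_P[OF l] prefix_mm)
      then show "(P (Suc l) \<odot> A \<odot> P (Suc l)) i j = (P (Suc l) \<odot> A) i j" by simp
    qed
    also have "\<dots> = (\<Sum>l<N. if i \<in> site n (Suc l) then A i j else 0)"
      by (intro sum.cong) (auto simp: P_left)
    also have "\<dots> = A i j"
    proof (cases "A i j = 0")
      case False
      then obtain k where k: "1 \<le> k" "k \<le> N" "i \<in> site n k" using bulk_sites[OF assms(1)] by metis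
      have "(\<Sum>l<N. if i \<in> site n (Suc l) then A i j else 0) = (\<Sum>l<N. if l = k - 1 then A i j else 0)"
      proof (rule sum.cong[OF refl])
        fix l
        have "i \<in> site n (Suc l) \<longleftrightarrow> l = k - 1"
          using k site_disjoint[OF k(3), of "Suc l"] by auto
        then show "(if i \<in> site n (Suc l) then A i j else 0) = (if l = k - 1 then A i j else 0)" by simp
      qed
      then show ?thesis using k by auto
    qed (auto intro: sum.neutral)
    finally show "A i j = (\<Sum>j<N. P (Suc j) \<odot> A \<odot> P (Suc j)) i j" by simp
  qed
  then have "inner L v (A \<cdot> v) = (\<Sum>j<N. inner L v ((P (Suc j) \<odot> A \<odot> P (Suc j)) \<cdot> v))"
    by (metis app_sum_left inner_sum)
  also have "\<dots> = (\<Sum>j<N. inner L (P (Suc j) \<cdot> v) (A \<cdot> P (Suc j) \<cdot> v))"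
    unfolding app_mm[OF fin] by (subst inner_app) (simp add: adj_Pk)
  finally show ?thesis .
qed

text \<open>The weight \<open>gibbs j\<close> belongs to the site \<open>j + 1\<close>.\<close>
definition gibbs :: "nat \<Rightarrow> real" where
  "gibbs j = exp (\<Sum>i\<le>j. beta Gm Gp i)"

lemma gibbs_0: "gibbs 0 = 1" and gibbs_Suc: "gibbs (Suc j) = exp (beta Gm Gp (Suc j)) * gibbs j"
  and gibbs_pos: "gibbs j > 0"
  by (auto simp: gibbs_def beta_def exp_add mult.commute)

end

section \<open>The ladder of vectors below the highest occupied site \<open>m + 1\<close>\<close>

locale ladder = transport_chain +
  fixes \<rho> :: lop and m :: nat and x :: lvec
  assumes pos: "positive_op L \<rho>" and bulk: "bulk \<rho>" and bal: "balanced \<rho>"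
    and m: "m < N" and x: "x \<in> vecs (site n (Suc m))" and nz: "\<rho> \<cdot> x \<noteq> 0"
    and top: "\<And>k v. k \<le> N \<Longrightarrow> Suc m < k \<Longrightarrow> v \<in> vecs (site n k) \<Longrightarrow> \<rho> \<cdot> v = 0"
begin

text \<open>Both \<open>y j\<close> and \<open>w j\<close> live on site \<open>j + 1\<close>; the
  index counts the steps up from the first site.\<close>

definition y :: "nat \<Rightarrow> lvec" where "y j = Zadjpow N n (m - j) x"
definition w :: "nat \<Rightarrow> lvec" where "w j = \<rho> \<cdot> y j"

lemma herm: "adj \<rho> = \<rho>" using bulk by (simp add: bulk_def)

lemma y_site: "j \<le> m \<Longrightarrow> y j \<in> vecs (site n (Suc j))"
  and y_down: "j < m \<Longrightarrow> y j = Z' (Suc j) \<cdot> y (Suc j)"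
proof -
  have down: "y j = Z' (Suc j) \<cdot> y (Suc j)" if "j < m" "y (Suc j) \<in> vecs (site n (Suc (Suc j)))" for j
  proof -
    have "m - j = Suc (m - Suc j)" using that by simp
    then have "y j = adj (Zop N n) \<cdot> y (Suc j)" by (simp add: y_def Zadjpow_def)
    then show ?thesis using app_Zop(2)[OF that(2)] that m by simp
  qed
  have *: "y j \<in> vecs (site n (Suc j))" if "j \<le> m" for j
    using that
  proof (induction rule: inc_induct)
    case base
    then show ?case using x by (simp add: y_def Zadjpow_def)
  next
    case (step j)
    then show ?case using down[of j] app_Z'_vecs by simp
  qed
  then show "j \<le> m \<Longrightarrow> y j \<in> vecs (site n (Suc j))" .
  show "j < m \<Longrightarrow> y j = Z' (Suc j) \<cdot> y (Suc j)" using down * by simp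
qed

lemma y_m: "y m = x" by (simp add: y_def Zadjpow_def)

lemma y_L: "j \<le> m \<Longrightarrow> y j \<in> vecs L"
  using site_vecs_L[OF y_site] m by simp

lemma w_site: "j \<le> m \<Longrightarrow> w j \<in> vecs (site n (Suc j))"
  unfolding w_def using balanced_site_vecs[OF bal y_site] m by simp

lemma w_L: "j \<le> m \<Longrightarrow> w j \<in> vecs L"
  using site_vecs_L[OF w_site] m by simp

text \<open>The coisometry property recovers \<open>y (Suc j)\<close> from \<open>y j\<close>, and
  intertwining carries this through \<open>\<rho>\<close>.\<close>

lemma Z_w: "j < m \<Longrightarrow> Z (Suc j) \<cdot> w j = vscale (of_real (1 / exp (beta Gm Gp (Suc j)))) (w (Suc j))"
proof -
  assume j: "j < m"
  have "Z (Suc j) \<cdot> y j = (Z (Suc j) \<odot> Z' (Suc j)) \<cdot> y (Suc j)"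
    using y_down[OF j] by (simp add: app_mm[OF fin])
  also have "\<dots> = y (Suc j)"
    using j m y_site[of "Suc j"] by (simp add: Z_Z' app_P)
  finally show ?thesis
    unfolding w_def using app_Z_balanced[OF bal, of "Suc j" "y j"] j m by simp
qed

text \<open>Moved past \<open>\<rho>\<close>, the operator \<open>Z (Suc m)\<close> takes
  \<open>x\<close> to a site that \<open>\<rho>\<close> annihilates.\<close>

lemma Z_w_top: "Suc m < N \<Longrightarrow> Z (Suc m) \<cdot> w m = 0"
  unfolding w_def y_m using app_Z_balanced[OF bal, of "Suc m" x] top[OF _ _ app_Z_vecs[of "Suc m" x]]
  by (simp add: vscale_0)

lemma Z'_w: "j < m \<Longrightarrow> Z' (Suc j) \<cdot> w (Suc j) = vscale (of_real (exp (beta Gm Gp (Suc j)))) (w j)"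
  unfolding w_def using app_Z'_balanced[OF bulk bal, of "Suc j" "y (Suc j)"] y_down[of j] m by simp

lemma Zpow_w: "j \<le> m \<Longrightarrow> Zpow N n j (w 0) = vscale (of_real (1 / gibbs j)) (w j)"
proof (induction j)
  case 0
  then show ?case by (simp add: Zpow_def gibbs_0 vscale_1)
next
  case (Suc j)
  then have "Zpow N n (Suc j) (w 0) = vscale (of_real (1 / gibbs j)) (Zop N n \<cdot> w j)"
    by (simp add: Zpow_def app_vscale)
  also have "Zop N n \<cdot> w j = Z (Suc j) \<cdot> w j"
    using app_Zop(1)[OF w_site[of j]] Suc.prems m by simp
  also have "\<dots> = vscale (of_real (1 / exp (beta Gm Gp (Suc j)))) (w (Suc j))"
    using Z_w Suc.prems by simp
  finally show ?case by (simp add: vscale_vscale gibbs_Suc mult.commute)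
qed

lemma Zpow_w_top: "m < j \<Longrightarrow> Zpow N n j (w 0) = 0"
proof (induction j)
  case (Suc j)
  show ?case
  proof (cases "j = m")
    case True
    \<comment> \<open>Either site \<open>m + 1\<close> is the last one, where \<open>Zop\<close> is
      zero, or \<open>Z_w_top\<close> applies.\<close>
    have "Zop N n \<cdot> w m = 0"
      using app_Zop(1)[OF w_site[of m]] Z_w_top m by auto
    then show ?thesis using Zpow_w[of m] True by (simp add: Zpow_def app_vscale vscale_0)
  next
    case False
    then have "Zpow N n j (w 0) = 0" using Suc by (simp add: zero_fun_def)
    then show ?thesis using app_0(1) by (simp only: Zpow_def funpow.simps comp_apply)
  qed
qed simp

text \<open>The weights are reciprocal because \<open>w j\<close> is \<open>gibbs j\<close> times
  the \<open>j\<close>-th power of \<open>Z\<close> on \<open>w 0\<close>; in terms of these powers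
  the weight becomes \<open>gibbs j\<close>.\<close>

definition \<sigma> :: lop where
  "\<sigma> = (\<Sum>j\<le>m. smul (of_real (1 / gibbs j)) (outer (w j) (w j)))"

lemma bulk_\<sigma>: "bulk \<sigma>"
proof -
  have "\<sigma> \<in> ops L"
    using w_L by (auto simp: ops_def \<sigma>_def sum_fun_app smul_def outer_def vecs_def intro!: sum.neutral)
  moreover have "adj \<sigma> = \<sigma>"
    by (simp add: \<sigma>_def adj_sum adj_smul adj_outer)
  \<comment> \<open>Each \<open>w j\<close> is in the range of the self-adjoint
    \<open>\<rho>\<close>, so the kernel of \<open>\<rho>\<close> is contained in that of
    \<open>\<sigma>\<close>.\<close>
  moreover have "\<sigma> \<cdot> s = 0" if "\<rho> \<cdot> s = 0" for s
  proof -
    have "inner L (w j) s = 0" for j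
      using inner_app[of L "y j" \<rho> s] that by (simp add: herm w_def inner_0)
    then show ?thesis by (simp add: \<sigma>_def app_sum_left app_smul app_outer vscale_0)
  qed
  ultimately show ?thesis using bulk by (simp add: bulk_def)
qed

text \<open>With \<open>k = i + 1\<close>, both sides of the intertwining relation reduce to the
  single dyad of \<open>w k\<close> and \<open>w i\<close> with weight \<open>1 / gibbs i\<close>,
  or to zero if \<open>k\<close> exceeds \<open>m\<close>. On the left it comes from the summand
  \<open>k\<close>, on the right from the summand \<open>i\<close>.\<close>

lemma balanced_\<sigma>: "balanced \<sigma>"
proof -
  have "P k \<odot> \<sigma> = \<sigma> \<odot> P k" if "k \<in> {1..N}" for k
    unfolding \<sigma>_def mm_linear mm_outer_left mm_outer_right adj_Pk
    using that app_P[OF w_site] by (intro sum.cong) (auto simp: outer_0)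
  moreover have "\<sigma> \<odot> Z k = smul (of_real (exp (beta Gm Gp k))) (Z k \<odot> \<sigma>)" if k: "k \<in> {1..N-1}" for k
  proof -
    obtain i where i: "k = Suc i" using k by (cases k) auto
    have "\<sigma> \<odot> Z k = (\<Sum>j\<le>m. if j = k then smul (of_real (1 / gibbs i)) (outer (w k) (w i)) else 0)"
      unfolding \<sigma>_def mm_linear mm_outer_left
    proof (rule sum.cong[OF refl])
      fix j assume j: "j \<in> {..m}"
      show "smul (of_real (1 / gibbs j)) (outer (w j) (Z' k \<cdot> w j))
        = (if j = k then smul (of_real (1 / gibbs i)) (outer (w k) (w i)) else 0)"
      proof (cases "j = k")
        case True
        then have "Z' k \<cdot> w j = vscale (of_real (exp (beta Gm Gp k))) (w i)" using i j Z'_w by simp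
        then show ?thesis
          using True i outer_vscale[of 1] by (simp add: vscale_1 smul_smul gibbs_Suc)
      next
        case False
        then have "Z' k \<cdot> w j = 0" using app_Z'_other[OF w_site] j by simp
        then show ?thesis using False by (simp add: outer_0 smul_0)
      qed
    qed
    also have "\<dots> = (if i < m then smul (of_real (1 / gibbs i)) (outer (w k) (w i)) else 0)"
      using i by auto
    also have "\<dots> = (\<Sum>j\<le>m. if j = i then (if i < m then smul (of_real (1 / gibbs i)) (outer (w k) (w i)) else 0) else 0)"
      by auto
    also have "\<dots> = smul (of_real (exp (beta Gm Gp k))) (Z k \<odot> \<sigma>)"
      unfolding \<sigma>_def mm_linear mm_outer_right smul_sum
    proof (rule sum.cong[OF refl])
      fix j assume j: "j \<in> {..m}"
      have "Z k \<cdot> w j = (if j = i \<and> i < m then vscale (of_real (1 / exp (beta Gm Gp k))) (w k) else 0)"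
        using app_Z_other[OF w_site[of j], of k] j i Z_w Z_w_top k by (cases "j = m"; cases "i = m") auto
      then show "(if j = i then (if i < m then smul (of_real (1 / gibbs i)) (outer (w k) (w i)) else 0) else 0)
        = smul (of_real (exp (beta Gm Gp k))) (smul (of_real (1 / gibbs j)) (outer (Z k \<cdot> w j) (w j)))"
        using outer_vscale[of _ _ 1] by (auto simp: vscale_1 smul_smul outer_0 smul_0)
    qed
    finally show ?thesis .
  qed
  ultimately show ?thesis by (auto simp: balanced_def)
qed

text \<open>Each step up the ladder multiplies the expectation of \<open>\<rho>\<close> by one Gibbs
  factor, so after division by \<open>gibbs j\<close> the same constant \<open>b\<close> serves all
  sites.\<close>

lemma inner_y: "j \<le> m \<Longrightarrow> inner L (y j) (w j) = of_real (gibbs j) * inner L (y 0) (w 0)"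
proof (induction j)
  case (Suc j)
  then have j: "j < m" by simp
  have "inner L (y j) (w j) = inner L (y (Suc j)) (Z (Suc j) \<cdot> w j)"
    using y_down[OF j] by (simp add: inner_app)
  also have "\<dots> = of_real (1 / exp (beta Gm Gp (Suc j))) * inner L (y (Suc j)) (w (Suc j))"
    using Z_w[OF j] by (simp add: inner_vscale)
  finally have "inner L (y (Suc j)) (w (Suc j)) = of_real (exp (beta Gm Gp (Suc j))) * inner L (y j) (w j)"
    by simp
  then show ?case using Suc by (simp add: gibbs_Suc)
qed (simp add: gibbs_0)

definition b :: real where "b = Re (inner L (y 0) (w 0))"

lemma b_pos: "b > 0" and inner_w: "j \<le> m \<Longrightarrow> inner L (y j) (w j) = of_real (gibbs j * b)"
proof -
  have 0: "inner L (y 0) (w 0) = of_real b"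
    using positive_op_real(1)[OF pos y_L[of 0]] by (simp add: b_def w_def)
  show *: "j \<le> m \<Longrightarrow> inner L (y j) (w j) = of_real (gibbs j * b)" for j
    using inner_y[of j] 0 by simp
  have "Re (inner L x (\<rho> \<cdot> x)) > 0"
    using y_L[of m] nz by (intro positive_op_pos[OF fin pos]) (auto simp: y_m)
  then show "b > 0"
    using *[of m] gibbs_pos[of m] by (simp add: w_def y_m zero_less_mult_iff)
qed

lemma inner_\<sigma>: "inner L v (\<sigma> \<cdot> v) = of_real (\<Sum>j\<le>m. (cmod (inner L (w j) v))\<^sup>2 / gibbs j)"
proof -
  have "inner L v (\<sigma> \<cdot> v) = (\<Sum>j\<le>m. of_real (1 / gibbs j) * (inner L (w j) v * inner L v (w j)))"
    by (simp add: \<sigma>_def app_sum_left app_smul app_outer inner_sum inner_vscale)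
  also have "\<dots> = (\<Sum>j\<le>m. of_real ((cmod (inner L (w j) v))\<^sup>2 / gibbs j))"
    by (intro sum.cong[OF refl], subst (2) inner_commute) (simp add: complex_norm_square[symmetric])
  finally show ?thesis by simp
qed

lemma positive_\<sigma>: "positive_op L \<sigma>"
  using bulk_\<sigma> gibbs_pos by (auto simp: positive_op_def bulk_def inner_\<sigma> intro!: sum_nonneg divide_nonneg_pos
    simp del: of_real_sum)

text \<open>Cauchy-Schwarz on site \<open>j + 1\<close> produces the factor
  \<open>gibbs j * b\<close>, whose Gibbs part the weight in \<open>\<sigma>\<close> cancels. Block
  diagonality of \<open>\<rho>\<close> lets the site bounds add up.\<close>

lemma \<sigma>_le: "v \<in> vecs L \<Longrightarrow> Re (inner L v (\<sigma> \<cdot> v)) \<le> b * Re (inner L v (\<rho> \<cdot> v))"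
proof -
  assume v: "v \<in> vecs L"
  define f where "f j = Re (inner L (P (Suc j) \<cdot> v) (\<rho> \<cdot> P (Suc j) \<cdot> v))" for j
  have Pv: "j < N \<Longrightarrow> P (Suc j) \<cdot> v \<in> vecs L" for j
    using site_vecs_L[OF app_P_vecs] by simp
  have "Re (inner L v (\<sigma> \<cdot> v)) = (\<Sum>j\<le>m. (cmod (inner L (w j) v))\<^sup>2 / gibbs j)"
    by (simp only: inner_\<sigma> Re_complex_of_real)
  also have "\<dots> \<le> (\<Sum>j\<le>m. b * f j)"
  proof (rule sum_mono)
    fix j assume "j \<in> {..m}"
    then have j: "j \<le> m" "j < N" using m by auto
    have "w j = P (Suc j) \<cdot> w j" using app_P[OF w_site[OF j(1)]] j by simp
    then have "inner L (w j) v = inner L (w j) (P (Suc j) \<cdot> v)"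
      by (metis adj_Pk inner_app)
    also have "\<dots> = inner L (y j) (\<rho> \<cdot> P (Suc j) \<cdot> v)"
      by (simp add: w_def inner_app herm)
    finally have "(cmod (inner L (w j) v))\<^sup>2 \<le> Re (inner L (y j) (\<rho> \<cdot> y j)) * f j"
      unfolding f_def using positive_op_cauchy_schwarz[OF fin pos y_L[OF j(1)] Pv[OF j(2)]] by simp
    then have "(cmod (inner L (w j) v))\<^sup>2 \<le> gibbs j * b * f j"
      using inner_w[OF j(1)] by (simp add: w_def)
    then show "(cmod (inner L (w j) v))\<^sup>2 / gibbs j \<le> b * f j"
      using gibbs_pos[of j] by (simp add: field_simps)
  qed
  also have "\<dots> \<le> (\<Sum>j<N. b * f j)"
    using m b_pos positive_op_real(2)[OF pos Pv] by (intro sum_mono2) (auto simp: f_def)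
  also have "\<dots> = b * Re (inner L v (\<rho> \<cdot> v))"
    by (subst balanced_inner_sum[OF bulk bal]) (simp add: f_def sum_distrib_left)
  finally show ?thesis .
qed

lemma \<sigma>_nonzero: "\<sigma> \<noteq> 0"
proof
  assume "\<sigma> = 0"
  then have "(\<Sum>j\<le>m. (cmod (inner L (w j) x))\<^sup>2 / gibbs j) = 0"
    using inner_\<sigma>[of x] by (simp add: app_0 inner_0 del: of_real_sum)
  \<comment> \<open>The top term is decisive, since its overlap with \<open>x\<close> is the
    positive expectation of \<open>\<rho>\<close> at \<open>x\<close>.\<close>
  then have "inner L (w m) x = 0"
    using gibbs_pos by (subst (asm) sum_nonneg_eq_0_iff) (auto intro!: divide_nonneg_pos simp: less_imp_neq[symmetric])
  then have "inner L (y m) (w m) = 0" by (subst inner_commute) (simp add: y_m)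
  then show False using inner_w[of m] b_pos gibbs_pos[of m] by simp
qed

lemma extremal_eq:
  assumes "invariant_extremal N n Gm Gp gm gp \<rho>"
  shows "\<exists>r>0. \<rho> = smul (of_real r) \<sigma>"
proof -
  \<comment> \<open>By \<open>\<sigma>_le\<close> this scaling puts \<open>\<sigma>\<close> below
    \<open>\<rho>\<close>.\<close>
  define s where "s = 1 / b"
  have s: "s > 0" using b_pos by (simp add: s_def)
  have "positive_op L (\<rho> - smul (of_real s) \<sigma>)"
    unfolding positive_op_def
  proof (intro conjI ballI)
    show "\<rho> - smul (of_real s) \<sigma> \<in> ops L"
      using bulk bulk_\<sigma> by (auto simp: bulk_def ops_def smul_def)
    fix v assume v: "v \<in> vecs L"
    have eq: "inner L v ((\<rho> - smul (of_real s) \<sigma>) \<cdot> v) = inner L v (\<rho> \<cdot> v) - of_real s * inner L v (\<sigma> \<cdot> v)"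
      by (simp add: app_diff_left app_smul inner_diff inner_vscale)
    have im: "Im (inner L v (\<rho> \<cdot> v)) = 0" "Im (inner L v (\<sigma> \<cdot> v)) = 0"
      using pos positive_\<sigma> v by (auto simp: positive_op_def)
    show "Im (inner L v ((\<rho> - smul (of_real s) \<sigma>) \<cdot> v)) = 0"
      by (simp add: eq im)
    show "0 \<le> Re (inner L v ((\<rho> - smul (of_real s) \<sigma>) \<cdot> v))"
    proof -
      have "s * Re (inner L v (\<sigma> \<cdot> v)) \<le> Re (inner L v (\<rho> \<cdot> v))"
        using \<sigma>_le[OF v] b_pos unfolding s_def by (simp add: field_simps)
      then show ?thesis by (simp add: eq im)
    qed
  qed
  moreover have "gen N n Gm Gp gm gp (smul (of_real s) \<sigma>) = 0"
    by (simp add: gen_smul balanced_gen[OF bulk_\<sigma> balanced_\<sigma>] smul_0)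
  moreover have "smul (of_real s) \<sigma> \<noteq> 0" using s \<sigma>_nonzero smul_eq_0 by fastforce
  ultimately obtain t where "t > 0" "\<rho> = smul (of_real t) (smul (of_real s) \<sigma>)"
    using extremal_dominated[OF fin assms positive_op_smul[OF positive_\<sigma>, of s]] s by auto
  then show ?thesis using s by (intro exI[of _ "t * s"]) (simp add: smul_smul)
qed

lemma sum_Zpow:
  "(\<Sum>j<N. smul (of_real (gibbs j)) (outer (Zpow N n j (vscale (of_real c) (w 0))) (Zpow N n j (vscale (of_real c) (w 0)))))
    = smul (of_real (c\<^sup>2)) \<sigma>"
proof -
  have sc: "Zpow N n j (vscale a v) = vscale a (Zpow N n j v)" for j a v
    unfolding Zpow_def by (induction j) (auto simp: app_vscale)
  have "smul (of_real (gibbs j)) (outer (Zpow N n j (vscale (of_real c) (w 0))) (Zpow N n j (vscale (of_real c) (w 0))))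
      = (if j \<le> m then smul (of_real (c\<^sup>2)) (smul (of_real (1 / gibbs j)) (outer (w j) (w j))) else 0)" for j
    unfolding sc using gibbs_pos[of j]
    by (auto simp: Zpow_w Zpow_w_top outer_0 smul_0 vscale_0 vscale_vscale outer_vscale smul_smul
        power2_eq_square not_le)
  then show ?thesis
    unfolding \<sigma>_def smul_sum using m by (simp add: sum.If_cases) (intro sum.cong, auto)
qed

lemma conclusion:
  assumes ext: "invariant_extremal N n Gm Gp gm gp \<rho>" and supp: "supported_on L \<rho> (Vsp N n)"
  shows "(\<exists>u\<in>Wsp N n Gm Gp. inner L u u = 1 \<and> \<rho> = outer u u)
       \<or> (\<exists>u\<in>V1sp N n \<inter> orth L (Wsp N n Gm Gp).
            \<rho> = (\<Sum>j<N. smul (of_real (gibbs j)) (outer (Zpow N n j u) (Zpow N n j u))))"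
proof -
  obtain r where r: "r > 0" "\<rho> = smul (of_real r) \<sigma>" using extremal_eq[OF ext] by blast
  \<comment> \<open>The proportionality factor is absorbed into the vector, where it enters
    quadratically.\<close>
  define c where "c = sqrt r"
  define u where "u = vscale (of_real c) (w 0)"
  have c: "c\<^sup>2 = r" using r by (simp add: c_def)
  have u_site: "u \<in> vecs (site n 1)" using w_site[of 0] by (simp add: u_def vecs_vscale)
  have u_V: "u \<in> Vsp N n"
    \<comment> \<open>\<open>u\<close> is the image under \<open>\<rho>\<close> of a multiple of
      \<open>y 0\<close>.\<close>
    using supp y_L[of 0] vecs_vscale unfolding supported_on_def u_def w_def app_vscale[symmetric] by blast
  have eq: "\<rho> = (\<Sum>j<N. smul (of_real (gibbs j)) (outer (Zpow N n j u) (Zpow N n j u)))"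
    unfolding u_def sum_Zpow c by (rule r(2))
  show ?thesis
  proof (cases "m = 0")
    \<comment> \<open>Only the first site is occupied: \<open>\<sigma>\<close> is a single dyad and
      every Kraus operator and its adjoint annihilate \<open>u\<close>.\<close>
    case True
    have "\<sigma> = outer (w 0) (w 0)"
      unfolding \<sigma>_def by (simp add: True gibbs_0 smul_1)
    then have out: "\<rho> = outer u u"
      using r(2) c by (simp add: u_def outer_vscale power2_eq_square flip: of_real_mult)
    have "tr L \<rho> = 1" using ext by (simp add: invariant_extremal_def invariant_state_def is_state_def)
    then have one: "inner L u u = 1"
      by (simp add: out tr_def inner_def outer_def mult.commute)
    have Zu: "Z k \<cdot> u = 0" "Z' k \<cdot> u = 0" if "1 \<le> k" "k < N" for k
    proof -
      show "Z' k \<cdot> u = 0" using app_Z'_other[OF u_site] that by simp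
      show "Z k \<cdot> u = 0"
      proof (cases "k = 1")
        case True
        then show ?thesis using Z_w_top \<open>m = 0\<close> that by (simp add: u_def app_vscale vscale_0)
      qed (use app_Z_other[OF u_site] in simp)
    qed
    have "Zpow N n 0 (phi n 1 0) \<in> Vexcl N n" "Zadjpow N n 0 (phi n N 0) \<in> Vexcl N n"
      "ket Mn \<in> Vexcl N n" "ket Pl \<in> Vexcl N n"
      unfolding Vexcl_def by blast+
    then have "inner L (phi n 1 0) u = 0" "inner L (phi n N 0) u = 0"
      "inner L (ket Mn) u = 0" "inner L (ket Pl) u = 0"
      using u_V by (auto simp: Vsp_def orth_def Zpow_def Zadjpow_def)
    then have "app L (kraus N n Gm Gp f e) u = 0 \<and> app L (adj (kraus N n Gm Gp f e)) u = 0"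
      if "f \<in> freqs N" for f e
      using that Zu
      by (cases e) (auto simp: freqs_def kraus_def adj_smul adj_outer adj_adj app_smul app_outer app_0 adj_0
          vscale_0 zero_fun_def[symmetric] simp del: One_nat_def)
    then have "u \<in> Wsp N n Gm Gp"
      using u_V unfolding Wsp_def by (auto simp: Vsp_def orth_def zero_fun_def)
    then show ?thesis using one out by blast
  next
    case False
    have "u = P 1 \<cdot> u" using app_P[OF u_site] m by simp
    then have "u \<in> V1sp N n" using u_V unfolding V1sp_def by blast
    moreover have "inner L s u = 0" if s: "s \<in> Wsp N n Gm Gp" for s
    proof -
      have f: "Wk 1 \<in> freqs N" using N2 by (auto simp: freqs_def)
      then have "app L (kraus N n Gm Gp (Wk 1) Neg) s = 0"
        using s unfolding Wsp_def zero_fun_def by blast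
      then have "vscale (1 / of_real (sqrt (Gm (Wk 1)))) (vscale (of_real (sqrt (Gm (Wk 1)))) (Z 1 \<cdot> s)) = 0"
        by (simp add: kraus_def app_smul vscale_0)
      then have Zs: "Z 1 \<cdot> s = 0"
        using rates_pos f by (auto simp: vscale_vscale vscale_1)
      \<comment> \<open>\<open>u\<close> is a multiple of the adjoint of \<open>Z 1\<close> applied
        to \<open>w 1\<close>, while \<open>Z 1\<close> annihilates all of W.\<close>
      have "w 0 = vscale (of_real (1 / exp (beta Gm Gp 1))) (Z' 1 \<cdot> w 1)"
        using Z'_w[of 0] False by (simp add: vscale_vscale vscale_1)
      then show ?thesis
        by (simp add: u_def inner_vscale inner_app adj_adj Zs[simplified] inner_0)
    qed
    then have "u \<in> orth L (Wsp N n Gm Gp)"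
      using u_V by (auto simp: orth_def Vsp_def)
    ultimately show ?thesis using eq by blast
  qed
qed

end

section \<open>Choice of the highest occupied site and conclusion\<close>

theorem theorem3p23:
  fixes N :: nat and n :: "nat \<Rightarrow> nat"
    and Gm Gp gm gp :: "freq \<Rightarrow> real" and \<rho> :: lop
  assumes "N \<ge> 2"
    and "\<forall>k. 1 \<le> k \<and> k < N \<longrightarrow> n (k + 1) \<le> n k"
    and "n N \<ge> 1"
    and "\<forall>w\<in>freqs N. Gm w > 0 \<and> Gp w > 0"
    and "invariant_extremal N n Gm Gp gm gp \<rho>"
    and "supported_on (lbls N n) \<rho> (Vsp N n)"
  shows "(\<exists>u\<in>Wsp N n Gm Gp. inner (lbls N n) u u = 1 \<and> \<rho> = outer u u)
       \<or> (\<exists>u\<in>V1sp N n \<inter> orth (lbls N n) (Wsp N n Gm Gp).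
            \<rho> = (\<Sum>m<N. smul (of_real (exp (\<Sum>j\<le>m. beta Gm Gp j)))
                           (outer (Zpow N n m u) (Zpow N n m u))))"
proof -
  interpret transport_chain N n Gm Gp gm gp
    using assms by unfold_locales
  have pos: "positive_op L \<rho>" and inv: "gen N n Gm Gp gm gp \<rho> = 0" and tr: "tr L \<rho> = 1"
    using assms(5) by (auto simp: invariant_extremal_def invariant_state_def is_state_def zero_fun_def)
  have bulk: "bulk \<rho>" using supported_bulk[OF pos assms(6)] .
  have bal: "balanced \<rho>" using gen_balanced[OF bulk inv] .
  \<comment> \<open>\<open>S m\<close> says that site \<open>m + 1\<close> is occupied. Unit trace
    provides an occupied site, and the greatest such \<open>m\<close> starts the ladder.\<close>
  define S where "S m \<longleftrightarrow> m < N \<and> (\<exists>x\<in>vecs (site n (Suc m)). \<rho> \<cdot> x \<noteq> 0)" for m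
  have "\<rho> \<noteq> 0" using tr by (auto simp: tr_def)
  then obtain i j where "\<rho> i j \<noteq> 0" by (auto simp: fun_eq_iff)
  then obtain l where l: "1 \<le> l" "l \<le> N" "j \<in> site n l" using bulk_sites[OF bulk] by metis
  have "\<rho> \<cdot> ket j \<noteq> 0"
    using \<open>\<rho> i j \<noteq> 0\<close> app_ket[OF fin site_L[OF l]] by (auto simp: fun_eq_iff)
  then have "S (l - 1)" unfolding S_def using l ket_vecs[OF l(3)] by auto
  moreover have "\<forall>m. S m \<longrightarrow> m \<le> N" by (auto simp: S_def)
  ultimately obtain m where m: "S m" "\<And>j. S j \<Longrightarrow> j \<le> m"
    by (metis GreatestI_nat Greatest_le_nat)
  then obtain x where x: "m < N" "x \<in> vecs (site n (Suc m))" "\<rho> \<cdot> x \<noteq> 0" by (auto simp: S_def)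
  have "\<rho> \<cdot> v = 0" if "k \<le> N" "Suc m < k" "v \<in> vecs (site n k)" for k v
  proof (rule ccontr)
    assume "\<rho> \<cdot> v \<noteq> 0"
    then have "S (k - 1)" unfolding S_def using that by auto
    then show False using m(2) that(2) by fastforce
  qed
  then interpret ladder N n Gm Gp gm gp \<rho> m x
    using pos bulk bal x by unfold_locales auto
  show ?thesis using conclusion[OF assms(5,6)] by (simp add: gibbs_def)
qed

end
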